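(* Let $(X,\mathrm{d}_X)$ be a proper geodesic Gromov hyperbolic metric space, let $o\in X$, let $\Gamma\subset\mathsf{Isom}(X)$ be a discrete group whose convergence action on $\partial_\infty X$ is non-elementary, and let $\psi\colon X\times X\to\mathbb{R}$ be a $\Gamma$-invariant coarsely additive potential. Define functions $\sigma_{\psi}, \bar\sigma_{\psi} \colon \Gamma \times \partial_\infty X \to [-\infty,\infty]$ and $G_{\psi} \colon \partial_\infty X^{(2)} \to [-\infty,\infty]$ by \begin{align*} \sigma_{\psi}(\gamma,x) & = \limsup_{p \rightarrow x} \, \psi(\gamma^{-1}o, p) - \psi(o,p), \\ \bar\sigma_{\psi}(\gamma,x) & = \limsup_{p \rightarrow x} \, \psi(p,\gamma^{-1}o) - \psi(p,o), \\ G_{\psi}(x,y) & = \limsup_{p \rightarrow x, q \rightarrow y}\, \psi(p,o) +\psi(o,q) - \psi(p,q), \end{align*} where $p,q$ range over $X$. Then these quantities are finite, $G_\psi$ is bounded below, $(\sigma_{\psi}, \bar\sigma_{\psi}, G_{\psi})$ is a coarse GPS system, and one can choose $\|\gamma\|_{\sigma_{\psi}} = \psi(o,\gamma o)$ as $\sigma_\psi$-magnitude.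
   Context: Potentials. A function $\psi\colon X\times X\to\mathbb{R}$ is a coarsely additive potential if: (1) $\lim_{r\to\infty}\inf_{\mathrm{d}_X(p,q)\ge r}\psi(p,q)=+\infty$; (2) for any $r>0$, $\sup_{\mathrm{d}_X(p,q)\le r}|\psi(p,q)|<+\infty$; (3) for every $r>0$ there is $\kappa=\kappa(r)>0$ such that if $u$ is contained in the $r$-neighborhood of a geodesic in $(X,\mathrm{d}_X)$ joining $p$ to $q$, then $|\psi(p,q)-(\psi(p,u)+\psi(u,q))|\le\kappa$. $\Gamma$-invariant means $\psi(\gamma p,\gamma q)=\psi(p,q)$ for all $\gamma\in\Gamma$. The group $\Gamma$ acts on the Gromov boundary $M:=\partial_\infty X$ as a convergence group; $\partial_\infty X^{(2)}$ denotes the set of ordered pairs of distinct points. Convergence groups. For $M$ compact metrizable, $\Gamma$ acts by homeomorphisms of $M$ as a (discrete) convergence group if for every sequence $\{\gamma_n\}$ of distinct elements there are $x,y\in M$ and a subsequence $\{\gamma_{n_j}\}$ such that $\gamma_{n_j}|_{M\smallsetminus\{y\}}$ converges locally uniformly to the constant $x$. The limit set $\Lambda(\Gamma)$ is the set of $x\in M$ for which there are $y\in M$ and $\{\gamma_n\}\subset\Gamma$ with $\gamma_n|_{M\smallsetminus\{y\}}\to x$ locally uniformly; the action is non-elementary if $\#\Lambda(\Gamma)\ge3$. $\gamma$ is loxodromic if it has two fixed points $\gamma^+\ne\gamma^-$ in $\Lambda(\Gamma)$ with $\gamma^{\pm n}|_{M\smallsetminus\{\gamma^{\mp}\}}\to\gamma^{\pm}$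 locally uniformly. $\Gamma\sqcup M$ carries a unique compact metrizable topology for which the inclusions of $\Gamma$ (discrete) and $M$ are embeddings and the natural $\Gamma$ action is a convergence action; a compatible metric $\mathrm{d}$ is a metric inducing it; fix one. Coarse-cocycles. $\sigma\colon\Gamma\times M\to\mathbb{R}$ is a $\kappa$-coarse-cocycle if (i) $\limsup_{x\to x_0}|\sigma(\gamma,x_0)-\sigma(\gamma,x)|\le\kappa$ for all $\gamma$, $x_0$, and (ii) $|\sigma(\gamma_1\gamma_2,x)-(\sigma(\gamma_1,\gamma_2x)+\sigma(\gamma_2,x))|\le\kappa$ for all $\gamma_1,\gamma_2,x$. It is proper if $\sigma(\gamma_n,\gamma_n^+)\to+\infty$ whenever $\{\gamma_n\}$ is a sequence of distinct loxodromic elements with $\liminf_n\mathrm{d}(\gamma_n^-,\gamma_n^+)>0$. A function $\gamma\mapsto\|\gamma\|_\sigma\in\mathbb{R}$ is a $\sigma$-magnitude if for every $\epsilon>0$ there is $C>0$ with $\|\gamma\|_\sigma-C\le\sigma(\gamma,x)\le\|\gamma\|_\sigma+C$ whenever $\mathrm{d}(x,\gamma^{-1})>\epsilon$ (with $\gamma^{-1}\in\Gamma\sqcup M$). GPS systems. $(\sigma,\bar\sigma,G)$ is a coarse GPS system if for some $\kappa\ge0$: $\sigma,\bar\sigma$ are proper $\kappa$-coarse-cocycles, $G\colon M^{(2)}\to\mathbb{R}$ is locally bounded, and $|(\bar\sigma(\gamma,x)+\sigma(\gamma,y))-(G(\gamma x,\gamma y)-G(x,y))|\le\kappa$ for all $\gamma\in\Gamma$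 and distinct $x,y\in M$. *)

theory Defs
  imports "HOL-Analysis.Analysis" "HOL-Algebra.Group_Action"
begin

section \<open>Proper geodesic Gromov hyperbolic spaces\<close>

text \<open>The metric space \<open>X\<close> is the whole carrier of a type of class \<^class>\<open>metric_space\<close>.\<close>

definition proper_space :: "'a::metric_space itself \<Rightarrow> bool" where
  "proper_space _ \<longleftrightarrow> (\<forall>(x::'a) r. compact (cball x r))"

definition geodesic_segment :: "'a::metric_space \<Rightarrow> 'a \<Rightarrow> 'a set \<Rightarrow> bool" where
  "geodesic_segment p q S \<longleftrightarrow>
     (\<exists>c::real \<Rightarrow> 'a. c 0 = p \<and> c (dist p q) = q \<and>
        (\<forall>s\<in>{0..dist p q}. \<forall>t\<in>{0..dist p q}. dist (c s) (c t) = \<bar>s - t\<bar>) \<and>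
        S = c ` {0..dist p q})"

definition geodesic_space :: "'a::metric_space itself \<Rightarrow> bool" where
  "geodesic_space _ \<longleftrightarrow> (\<forall>p q::'a. \<exists>S. geodesic_segment p q S)"

definition gromov_product :: "'a::metric_space \<Rightarrow> 'a \<Rightarrow> 'a \<Rightarrow> real" where
  "gromov_product a x y = (dist a x + dist a y - dist x y) / 2"

definition gromov_hyperbolic :: "'a::metric_space itself \<Rightarrow> bool" where
  "gromov_hyperbolic _ \<longleftrightarrow>
     (\<exists>\<delta>\<ge>0. \<forall>a x y z::'a.
        gromov_product a x z \<ge> min (gromov_product a x y) (gromov_product a y z) - \<delta>)"

section \<open>The Gromov boundary\<close>

text \<open>
  Points of the Gromov boundary are equivalence classes of sequences converging at infinity.
  Quantifying over all base points \<open>a\<close> keeps the definitions free of a base point; changing \<open>a\<close>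
  changes Gromov products by a bounded amount only.
\<close>

definition gromov_sequence :: "(nat \<Rightarrow> 'a::metric_space) \<Rightarrow> bool" where
  "gromov_sequence u \<longleftrightarrow>
     (\<forall>a. filterlim (\<lambda>(m, n). gromov_product a (u m) (u n)) at_top (sequentially \<times>\<^sub>F sequentially))"

definition gromov_equiv :: "(nat \<Rightarrow> 'a::metric_space) rel" where
  "gromov_equiv = {(u, v). gromov_sequence u \<and> gromov_sequence v \<and>
     (\<forall>a. filterlim (\<lambda>n. gromov_product a (u n) (v n)) at_top sequentially)}"

definition gromov_boundary :: "(nat \<Rightarrow> 'a::metric_space) set set" where
  "gromov_boundary = {u. gromov_sequence u} // gromov_equiv"

text \<open>
  The compactification \<open>X \<union> \<partial>X\<close> lives on the sum type. A point of it is represented by the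
  sequences in its class, respectively by a constant sequence.
\<close>

fun representatives :: "'a + (nat \<Rightarrow> 'a) set \<Rightarrow> (nat \<Rightarrow> 'a) set" where
  "representatives (Inl p) = {\<lambda>_. p}"
| "representatives (Inr \<xi>) = \<xi>"

definition extended_gromov_product ::
    "'a::metric_space \<Rightarrow> 'a + (nat \<Rightarrow> 'a) set \<Rightarrow> 'a + (nat \<Rightarrow> 'a) set \<Rightarrow> ereal" where
  "extended_gromov_product a x y =
     Inf {liminf (\<lambda>n. ereal (gromov_product a (u n) (v n))) | u v.
            u \<in> representatives x \<and> v \<in> representatives y}"

definition compactification_open :: "('a::metric_space + (nat \<Rightarrow> 'a) set) set \<Rightarrow> bool" where
  "compactification_open U \<longleftrightarrow>
     U \<subseteq> UNIV <+> gromov_boundary \<and>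
     open (Inl -` U) \<and>
     (\<forall>\<xi>. Inr \<xi> \<in> U \<longrightarrow> (\<forall>a. \<exists>R::real.
        {z \<in> UNIV <+> gromov_boundary. extended_gromov_product a (Inr \<xi>) z > R} \<subseteq> U))"

lemma istopology_compactification_open: "istopology compactification_open"
  unfolding istopology_def
proof (intro conjI allI impI)
  fix S T :: "('a + (nat \<Rightarrow> 'a) set) set"
  assume S: "compactification_open S" and T: "compactification_open T"
  show "compactification_open (S \<inter> T)"
    unfolding compactification_open_def
  proof (intro conjI allI impI)
    show "S \<inter> T \<subseteq> UNIV <+> gromov_boundary"
      using S by (auto simp: compactification_open_def)
    show "open (Inl -` (S \<inter> T))"
      using S T by (auto simp: compactification_open_def vimage_Int)
    fix \<xi> :: "(nat \<Rightarrow> 'a) set" and a :: 'a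
    assume "Inr \<xi> \<in> S \<inter> T"
    then obtain R R' :: real where
        "{z \<in> UNIV <+> gromov_boundary. extended_gromov_product a (Inr \<xi>) z > R} \<subseteq> S"
        "{z \<in> UNIV <+> gromov_boundary. extended_gromov_product a (Inr \<xi>) z > R'} \<subseteq> T"
      using S T unfolding compactification_open_def by (meson IntD1 IntD2)
    then have "{z \<in> UNIV <+> gromov_boundary.
                  extended_gromov_product a (Inr \<xi>) z > ereal (max R R')} \<subseteq> S \<inter> T"
      by (simp add: subset_iff max_def split: if_splits)
         (meson ereal_less_eq(3) le_less_trans linorder_linear)
    then show "\<exists>R::real. {z \<in> UNIV <+> gromov_boundary.
                  extended_gromov_product a (Inr \<xi>) z > R} \<subseteq> S \<inter> T"
      by blast
  qed
next
  fix \<U> :: "('a + (nat \<Rightarrow> 'a) set) set set"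
  assume *: "\<forall>U\<in>\<U>. compactification_open U"
  show "compactification_open (\<Union>\<U>)"
    unfolding compactification_open_def
  proof (intro conjI allI impI)
    show "\<Union>\<U> \<subseteq> UNIV <+> gromov_boundary"
      using * by (auto simp: compactification_open_def)
    show "open (Inl -` \<Union>\<U>)"
      unfolding vimage_Union using * by (auto simp: compactification_open_def)
    fix \<xi> :: "(nat \<Rightarrow> 'a) set" and a :: 'a
    assume "Inr \<xi> \<in> \<Union>\<U>"
    then obtain U where U: "U \<in> \<U>" "Inr \<xi> \<in> U" by blast
    with * obtain R :: real where
        "{z \<in> UNIV <+> gromov_boundary. extended_gromov_product a (Inr \<xi>) z > R} \<subseteq> U"
      unfolding compactification_open_def by meson
    with U show "\<exists>R::real. {z \<in> UNIV <+> gromov_boundary.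
                  extended_gromov_product a (Inr \<xi>) z > R} \<subseteq> \<Union>\<U>"
      by blast
  qed
qed

definition gromov_compactification :: "('a::metric_space + (nat \<Rightarrow> 'a) set) topology" where
  "gromov_compactification = topology compactification_open"

lemma openin_gromov_compactification:
  "openin gromov_compactification U \<longleftrightarrow> compactification_open U"
  by (simp add: gromov_compactification_def istopology_compactification_open topology_inverse')

lemma topspace_gromov_compactification:
  "topspace gromov_compactification = UNIV <+> gromov_boundary"
proof -
  have "compactification_open (UNIV <+> gromov_boundary)"
    by (auto simp: compactification_open_def vimage_def Plus_def)
  then show ?thesis
    by (metis compactification_open_def openin_gromov_compactification openin_subset
        openin_topspace subset_antisym)
qed

definition gromov_boundary_topology :: "(nat \<Rightarrow> 'a::metric_space) set topology" where
  "gromov_boundary_topology = pullback_topology gromov_boundary Inr gromov_compactification"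

lemma topspace_gromov_boundary_topology:
  "topspace gromov_boundary_topology = gromov_boundary"
  by (auto simp: gromov_boundary_topology_def topspace_pullback_topology
      topspace_gromov_compactification)

text \<open>The filter of \<open>p \<rightarrow> \<xi>\<close>, for \<open>p\<close> ranging over \<open>X\<close> and \<open>\<xi>\<close> a boundary point.\<close>

definition tending_to :: "(nat \<Rightarrow> 'a::metric_space) set \<Rightarrow> 'a filter" where
  "tending_to \<xi> = filtercomap Inl (nhdsin gromov_compactification (Inr \<xi>))"

section \<open>Isometries\<close>

text \<open>
  A set \<open>\<Gamma>\<close> of isometries is discrete if \<^term>\<open>discrete \<Gamma>\<close> holds for the library's topology on
  functions, that is, for pointwise convergence; on isometries this is the compact-open topology.
\<close>

definition isom_group :: "('a::metric_space \<Rightarrow> 'a) monoid" where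
  "isom_group = (BijGroup UNIV)
     \<lparr>carrier := {f \<in> Bij UNIV. \<forall>x y. dist (f x) (f y) = dist x y}\<rparr>"

lemma Bij_UNIV: "Bij (UNIV :: 'a set) = {f. bij f}"
  by (auto simp: Bij_def extensional_def)

lemma inv_BijGroup_UNIV:
  assumes "bij (f :: 'a \<Rightarrow> 'a)"
  shows "inv\<^bsub>BijGroup UNIV\<^esub> f = inv_into UNIV f"
  using inv_BijGroup[of f UNIV] assms by (simp add: Bij_UNIV restrict_def)

lemma subgroup_isometries:
  "subgroup {f \<in> Bij UNIV. \<forall>x y. dist (f x) (f y) = dist x y} (BijGroup (UNIV::'a::metric_space set))"
proof (rule group.subgroupI[OF group_BijGroup], goal_cases)
  case 1
  then show ?case by (auto simp: BijGroup_def)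
next
  case 2
  have "(id :: 'a \<Rightarrow> 'a) \<in> {f \<in> Bij UNIV. \<forall>x y. dist (f x) (f y) = dist x y}"
    by (auto simp: Bij_UNIV)
  then show ?case by blast
next
  case (3 f)
  then have f: "bij f" "\<And>x y. dist (f x) (f y) = dist x y"
    by (auto simp: Bij_UNIV)
  have "dist (inv_into UNIV f x) (inv_into UNIV f y) = dist x y" for x y
    using f(2)[of "inv_into UNIV f x" "inv_into UNIV f y"] f(1)
    by (simp add: bij_is_surj surj_f_inv_f)
  with f show ?case
    by (simp add: Bij_UNIV inv_BijGroup_UNIV bij_imp_bij_inv)
next
  case (4 f g)
  then show ?case
    by (auto simp: Bij_UNIV BijGroup_def compose_def restrict_def bij_comp[unfolded comp_def])
qed

lemma group_isom_group: "group isom_group"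
  unfolding isom_group_def
  by (rule group.subgroup_imp_group[OF group_BijGroup subgroup_isometries])

lemma inv_isom_group:
  assumes "f \<in> carrier isom_group"
  shows "inv\<^bsub>isom_group\<^esub> f = inv_into UNIV f"
  using assms group.m_inv_consistent[OF group_BijGroup subgroup_isometries, of f]
  by (auto simp: isom_group_def Bij_UNIV inv_BijGroup_UNIV)

definition boundary_action ::
    "('a::metric_space \<Rightarrow> 'a) \<Rightarrow> (nat \<Rightarrow> 'a) set \<Rightarrow> (nat \<Rightarrow> 'a) set" where
  "boundary_action \<gamma> \<xi> = (\<lambda>u. \<gamma> \<circ> u) ` \<xi>"

section \<open>Convergence groups\<close>

text \<open>
  Uniform convergence to a constant map does not depend on the choice of a metric (or uniformity)
  on a compact metrizable space, so it is expressed by neighbourhoods of the constant.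
\<close>

definition loc_unif_const ::
    "'m topology \<Rightarrow> (nat \<Rightarrow> 'm \<Rightarrow> 'm) \<Rightarrow> 'm \<Rightarrow> 'm \<Rightarrow> bool" where
  "loc_unif_const M f y x \<longleftrightarrow>
     (\<forall>z \<in> topspace M - {y}. \<exists>V. openin (subtopology M (topspace M - {y})) V \<and> z \<in> V \<and>
        (\<forall>U. openin M U \<and> x \<in> U \<longrightarrow> (\<forall>\<^sub>F n in sequentially. f n ` V \<subseteq> U)))"

text \<open>The restriction is needed because the maps in \<^const>\<open>BijGroup\<close> are extensional.\<close>

definition convergence_action ::
    "'g monoid \<Rightarrow> 'm topology \<Rightarrow> ('g \<Rightarrow> 'm \<Rightarrow> 'm) \<Rightarrow> bool" where
  "convergence_action G M \<phi> \<longleftrightarrow>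
     compact_space M \<and> metrizable_space M \<and>
     group_action G (topspace M) (\<lambda>g. restrict (\<phi> g) (topspace M)) \<and>
     (\<forall>g \<in> carrier G. homeomorphic_map M M (\<phi> g)) \<and>
     (\<forall>\<gamma>::nat \<Rightarrow> 'g. range \<gamma> \<subseteq> carrier G \<and> inj \<gamma> \<longrightarrow>
        (\<exists>x \<in> topspace M. \<exists>y \<in> topspace M. \<exists>r. strict_mono r \<and>
           loc_unif_const M (\<lambda>j. \<phi> (\<gamma> (r j))) y x))"

definition conv_limit_set :: "'g monoid \<Rightarrow> 'm topology \<Rightarrow> ('g \<Rightarrow> 'm \<Rightarrow> 'm) \<Rightarrow> 'm set" where
  "conv_limit_set G M \<phi> = {x \<in> topspace M. \<exists>y \<in> topspace M. \<exists>\<gamma>::nat \<Rightarrow> 'g.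
     range \<gamma> \<subseteq> carrier G \<and> loc_unif_const M (\<lambda>n. \<phi> (\<gamma> n)) y x}"

definition non_elementary :: "'g monoid \<Rightarrow> 'm topology \<Rightarrow> ('g \<Rightarrow> 'm \<Rightarrow> 'm) \<Rightarrow> bool" where
  "non_elementary G M \<phi> \<longleftrightarrow>
     infinite (conv_limit_set G M \<phi>) \<or> card (conv_limit_set G M \<phi>) \<ge> 3"

text \<open>\<open>\<gamma>\<close> is loxodromic with attracting fixed point \<open>a\<close> and repelling fixed point \<open>b\<close>.\<close>

definition loxodromic_with ::
    "'g monoid \<Rightarrow> 'm topology \<Rightarrow> ('g \<Rightarrow> 'm \<Rightarrow> 'm) \<Rightarrow> 'g \<Rightarrow> 'm \<Rightarrow> 'm \<Rightarrow> bool" where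
  "loxodromic_with G M \<phi> \<gamma> a b \<longleftrightarrow>
     \<gamma> \<in> carrier G \<and> a \<in> conv_limit_set G M \<phi> \<and> b \<in> conv_limit_set G M \<phi> \<and> a \<noteq> b \<and>
     \<phi> \<gamma> a = a \<and> \<phi> \<gamma> b = b \<and>
     loc_unif_const M (\<lambda>n. \<phi> (\<gamma> [^]\<^bsub>G\<^esub> n)) b a \<and>
     loc_unif_const M (\<lambda>n. \<phi> (inv\<^bsub>G\<^esub> \<gamma> [^]\<^bsub>G\<^esub> n)) a b"

text \<open>
  Metrics inducing the compact topology on the disjoint union of \<open>G\<close> (on the left) and \<open>M\<close>
  (on the right).
\<close>

definition compatible_metric ::
    "'g monoid \<Rightarrow> 'm topology \<Rightarrow> ('g \<Rightarrow> 'm \<Rightarrow> 'm) \<Rightarrow> ('g + 'm \<Rightarrow> 'g + 'm \<Rightarrow> real) \<Rightarrow> bool" where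
  "compatible_metric G M \<phi> d \<longleftrightarrow>
     Metric_space (carrier G <+> topspace M) d \<and>
     (let T = Metric_space.mtopology (carrier G <+> topspace M) d in
        compact_space T \<and>
        embedding_map (discrete_topology (carrier G)) T Inl \<and>
        embedding_map M T Inr \<and>
        convergence_action G T (\<lambda>g. map_sum (\<lambda>h. g \<otimes>\<^bsub>G\<^esub> h) (\<phi> g)))"

section \<open>Coarse-cocycles and GPS systems\<close>

definition coarse_cocycle ::
    "'g monoid \<Rightarrow> 'm topology \<Rightarrow> ('g \<Rightarrow> 'm \<Rightarrow> 'm) \<Rightarrow> real \<Rightarrow> ('g \<Rightarrow> 'm \<Rightarrow> real) \<Rightarrow> bool" where
  "coarse_cocycle G M \<phi> \<kappa> \<sigma> \<longleftrightarrow>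
     (\<forall>\<gamma> \<in> carrier G. \<forall>x0 \<in> topspace M.
        Limsup (atin M x0) (\<lambda>x. ereal \<bar>\<sigma> \<gamma> x0 - \<sigma> \<gamma> x\<bar>) \<le> ereal \<kappa>) \<and>
     (\<forall>\<gamma>1 \<in> carrier G. \<forall>\<gamma>2 \<in> carrier G. \<forall>x \<in> topspace M.
        \<bar>\<sigma> (\<gamma>1 \<otimes>\<^bsub>G\<^esub> \<gamma>2) x - (\<sigma> \<gamma>1 (\<phi> \<gamma>2 x) + \<sigma> \<gamma>2 x)\<bar> \<le> \<kappa>)"

definition proper_cocycle ::
    "'g monoid \<Rightarrow> 'm topology \<Rightarrow> ('g \<Rightarrow> 'm \<Rightarrow> 'm) \<Rightarrow> ('g + 'm \<Rightarrow> 'g + 'm \<Rightarrow> real) \<Rightarrow>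
     ('g \<Rightarrow> 'm \<Rightarrow> real) \<Rightarrow> bool" where
  "proper_cocycle G M \<phi> d \<sigma> \<longleftrightarrow>
     (\<forall>(\<gamma>::nat \<Rightarrow> 'g) a b. inj \<gamma> \<and> (\<forall>n. loxodromic_with G M \<phi> (\<gamma> n) (a n) (b n)) \<and>
        liminf (\<lambda>n. ereal (d (Inr (b n)) (Inr (a n)))) > 0 \<longrightarrow>
        filterlim (\<lambda>n. \<sigma> (\<gamma> n) (a n)) at_top sequentially)"

definition is_magnitude ::
    "'g monoid \<Rightarrow> 'm topology \<Rightarrow> ('g + 'm \<Rightarrow> 'g + 'm \<Rightarrow> real) \<Rightarrow>
     ('g \<Rightarrow> 'm \<Rightarrow> real) \<Rightarrow> ('g \<Rightarrow> real) \<Rightarrow> bool" where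
  "is_magnitude G M d \<sigma> N \<longleftrightarrow>
     (\<forall>\<epsilon>>0. \<exists>C>0. \<forall>\<gamma> \<in> carrier G. \<forall>x \<in> topspace M.
        d (Inr x) (Inl (inv\<^bsub>G\<^esub> \<gamma>)) > \<epsilon> \<longrightarrow> N \<gamma> - C \<le> \<sigma> \<gamma> x \<and> \<sigma> \<gamma> x \<le> N \<gamma> + C)"

definition distinct_pairs :: "'m topology \<Rightarrow> ('m \<times> 'm) set" where
  "distinct_pairs M = {(x, y). x \<in> topspace M \<and> y \<in> topspace M \<and> x \<noteq> y}"

definition locally_bounded :: "'b topology \<Rightarrow> ('b \<Rightarrow> real) \<Rightarrow> bool" where
  "locally_bounded T f \<longleftrightarrow> (\<forall>z \<in> topspace T. \<exists>U. openin T U \<and> z \<in> U \<and> bounded (f ` U))"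

definition coarse_GPS_system ::
    "'g monoid \<Rightarrow> 'm topology \<Rightarrow> ('g \<Rightarrow> 'm \<Rightarrow> 'm) \<Rightarrow> ('g + 'm \<Rightarrow> 'g + 'm \<Rightarrow> real) \<Rightarrow>
     ('g \<Rightarrow> 'm \<Rightarrow> real) \<Rightarrow> ('g \<Rightarrow> 'm \<Rightarrow> real) \<Rightarrow> ('m \<times> 'm \<Rightarrow> real) \<Rightarrow> bool" where
  "coarse_GPS_system G M \<phi> d \<sigma> \<sigma>' K \<longleftrightarrow>
     (\<exists>\<kappa>\<ge>0.
        coarse_cocycle G M \<phi> \<kappa> \<sigma> \<and> proper_cocycle G M \<phi> d \<sigma> \<and>
        coarse_cocycle G M \<phi> \<kappa> \<sigma>' \<and> proper_cocycle G M \<phi> d \<sigma>' \<and>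
        locally_bounded (subtopology (prod_topology M M) (distinct_pairs M)) K \<and>
        (\<forall>\<gamma> \<in> carrier G. \<forall>(x, y) \<in> distinct_pairs M.
           \<bar>(\<sigma>' \<gamma> x + \<sigma> \<gamma> y) - (K (\<phi> \<gamma> x, \<phi> \<gamma> y) - K (x, y))\<bar> \<le> \<kappa>))"

section \<open>Potentials\<close>

definition coarsely_additive_potential :: "('a::metric_space \<Rightarrow> 'a \<Rightarrow> real) \<Rightarrow> bool" where
  "coarsely_additive_potential \<psi> \<longleftrightarrow>
     ((\<lambda>r::real. INF (p, q) \<in> {(p, q). dist p q \<ge> r}. ereal (\<psi> p q)) \<longlongrightarrow> \<infinity>) at_top \<and>
     (\<forall>r>0. (SUP (p, q) \<in> {(p, q). dist p q \<le> r}. ereal \<bar>\<psi> p q\<bar>) < \<infinity>) \<and>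
     (\<forall>r>0. \<exists>\<kappa>>0. \<forall>p q u S. geodesic_segment p q S \<and> (\<exists>w\<in>S. dist u w < r) \<longrightarrow>
        \<bar>\<psi> p q - (\<psi> p u + \<psi> u q)\<bar> \<le> \<kappa>)"

definition invariant_potential :: "('a \<Rightarrow> 'a) set \<Rightarrow> ('a \<Rightarrow> 'a \<Rightarrow> real) \<Rightarrow> bool" where
  "invariant_potential \<Gamma> \<psi> \<longleftrightarrow> (\<forall>\<gamma>\<in>\<Gamma>. \<forall>p q. \<psi> (\<gamma> p) (\<gamma> q) = \<psi> p q)"

text \<open>In the following, \<open>b\<close> is the base point of \<open>X\<close> (\<open>o\<close> is reserved syntax in HOL).\<close>

definition sigma_potential ::
    "('a::metric_space \<Rightarrow> 'a \<Rightarrow> real) \<Rightarrow> 'a \<Rightarrow> ('a \<Rightarrow> 'a) \<Rightarrow> (nat \<Rightarrow> 'a) set \<Rightarrow> ereal" where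
  "sigma_potential \<psi> b \<gamma> x =
     Limsup (tending_to x) (\<lambda>p. ereal (\<psi> ((inv\<^bsub>isom_group\<^esub> \<gamma>) b) p - \<psi> b p))"

definition sigma_bar_potential ::
    "('a::metric_space \<Rightarrow> 'a \<Rightarrow> real) \<Rightarrow> 'a \<Rightarrow> ('a \<Rightarrow> 'a) \<Rightarrow> (nat \<Rightarrow> 'a) set \<Rightarrow> ereal" where
  "sigma_bar_potential \<psi> b \<gamma> x =
     Limsup (tending_to x) (\<lambda>p. ereal (\<psi> p ((inv\<^bsub>isom_group\<^esub> \<gamma>) b) - \<psi> p b))"

definition G_potential ::
    "('a::metric_space \<Rightarrow> 'a \<Rightarrow> real) \<Rightarrow> 'a \<Rightarrow> (nat \<Rightarrow> 'a) set \<times> (nat \<Rightarrow> 'a) set \<Rightarrow> ereal" where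
  "G_potential \<psi> b = (\<lambda>(x, y).
     Limsup (tending_to x \<times>\<^sub>F tending_to y) (\<lambda>(p, q). ereal (\<psi> p b + \<psi> b q - \<psi> p q)))"

end

(*
  By hyperbolicity the finite differences whose upper limits define sigma, sigma-bar and G are
  constant up to a uniform error near the boundary points in question. Hence the upper limits are
  finite, may be replaced by values at points of X close to the boundary, and the (exact)
  identities between these values, which express the invariance of the potential, become coarse
  identities. The quantities for sigma-bar are those of the reversed potential (p, q) |-> psi(q, p).
  If d(x, g) is bounded below, g in the group and x in the boundary, then so is the distance of
  x from g b in the compactification of X, that is, the Gromov product of x and g b is bounded:
  otherwise convergence dynamics would force x and g to converge to the same point. This gives
  the magnitude. Properness follows from it, because the attracting fixed points of loxodromic
  elements with well-separated fixed points stay away from the inverses of these elements.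
*)
theory Submission
  imports Defs
begin

section \<open>Gromov products\<close>

text \<open>The picture is a tree: \<psi>(e, p) - \<psi>(b, p) depends, up to a bounded error, only
  on where the geodesics from e and b to p merge, so it stops changing once p and p' agree beyond
  that point. How far out p must be depends on e and on the boundary point, but the error does not;
  this makes the constants of the coarse identities uniform over the group. The obstacle is the
  metric \<open>d\<close>: it is only known to induce a topology on which the group acts as a
  convergence group, and says nothing directly about the orbit of \<open>b\<close> in X. The two are
  compared through the boundary, which both compactifications share. An element \<gamma> is the
  image of the neutral element, and, when \<gamma> moves \<open>b\<close> far, \<gamma> b lies close
  to \<gamma> z for every boundary point z away from \<gamma>^-1 b. Along a convergence subsequence
  both \<gamma> and \<gamma> b are therefore driven to the same attracting point.\<close>

lemma gromov_product_commute: "gromov_product a x y = gromov_product a y x"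
  by (simp add: gromov_product_def dist_commute)

lemma gromov_product_nonneg: "0 \<le> gromov_product a x y"
  using dist_triangle3[of x y a] by (simp add: gromov_product_def)

lemma gromov_product_le_dist: "gromov_product a x y \<le> dist a x" "gromov_product a x y \<le> dist a y"
  using dist_triangle[of a y x] dist_triangle[of a x y]
  by (simp_all add: gromov_product_def dist_commute)

lemma gromov_product_base: "gromov_product a x y \<le> gromov_product a' x y + dist a a'"
  using dist_triangle[of a x a'] dist_triangle[of a y a']
  by (simp add: gromov_product_def field_simps)

lemma gromov_product_isometry:
  assumes "\<And>x y. dist (f x) (f y) = dist x y"
  shows "gromov_product (f a) (f x) (f y) = gromov_product a x y"
  by (simp add: gromov_product_def assms)

lemma gromov_sequenceD:
  assumes "gromov_sequence u"
  shows "\<exists>N. \<forall>m\<ge>N. \<forall>n\<ge>N. r \<le> gromov_product a (u m) (u n)"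
proof -
  have "eventually (\<lambda>(m, n). r \<le> gromov_product a (u m) (u n)) (sequentially \<times>\<^sub>F sequentially)"
    using assms by (auto simp: gromov_sequence_def filterlim_at_top case_prod_unfold)
  then obtain P Q where "eventually P sequentially" "eventually Q sequentially"
    and PQ: "\<And>m n. P m \<Longrightarrow> Q n \<Longrightarrow> r \<le> gromov_product a (u m) (u n)"
    unfolding eventually_prod_filter by auto
  then have "\<forall>\<^sub>F n in sequentially. P n \<and> Q n"
    by (intro eventually_conj)
  then show ?thesis
    using PQ unfolding eventually_sequentially by blast
qed

text \<open>An infimum of lower limits is at least \<open>c\<close> iff each of them is; passing to
  \<open>c' < c\<close> is needed because a lower limit \<open>c\<close> gives no eventual bound by
  \<open>c\<close> itself. Most later estimates have the form \<open>ereal c \<le> ...\<close>, so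
  that extended products reduce to real inequalities along sequences.\<close>

lemma le_extended_gromov_product_iff:
  "ereal c \<le> extended_gromov_product a x y \<longleftrightarrow>
     (\<forall>u\<in>representatives x. \<forall>v\<in>representatives y. \<forall>c'<c.
        \<forall>\<^sub>F n in sequentially. c' < gromov_product a (u n) (v n))"
proof -
  have liminf_iff: "ereal c \<le> liminf (\<lambda>n. ereal (f n)) \<longleftrightarrow> (\<forall>c'<c. \<forall>\<^sub>F n in sequentially. c' < f n)"
    for f :: "nat \<Rightarrow> real"
    unfolding le_Liminf_iff
  proof (intro iffI allI impI)
    fix y :: ereal assume *: "\<forall>c'<c. \<forall>\<^sub>F n in sequentially. c' < f n" and "y < ereal c"
    then show "\<forall>\<^sub>F n in sequentially. y < ereal (f n)"
      by (cases y) auto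
  next
    fix c' assume *: "\<forall>y<ereal c. \<forall>\<^sub>F n in sequentially. y < ereal (f n)" and "c' < c"
    then show "\<forall>\<^sub>F n in sequentially. c' < f n"
      using *[rule_format, of "ereal c'"] by simp
  qed
  show ?thesis
    unfolding extended_gromov_product_def le_Inf_iff liminf_iff[symmetric] by blast
qed

lemma extended_gromov_product_Inl:
  "ereal c \<le> extended_gromov_product a (Inl p) (Inl q) \<longleftrightarrow> c \<le> gromov_product a p q"
  using dense_le[of c "gromov_product a p q"]
  by (auto simp: le_extended_gromov_product_iff less_imp_le)

lemma extended_gromov_product_commute:
  "extended_gromov_product a x y = extended_gromov_product a y x"
proof -
  define k where "k u v = liminf (\<lambda>n. ereal (gromov_product a (u n) (v n)))" for u v
  have "k u v = k v u" for u v
    unfolding k_def by (subst gromov_product_commute) (rule refl)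
  then have "{k u v |u v. u \<in> A \<and> v \<in> B} = {k u v |u v. u \<in> B \<and> v \<in> A}" for A B
    by blast
  then show ?thesis
    by (simp add: extended_gromov_product_def k_def)
qed

lemma extended_gromov_product_base:
  assumes "ereal c \<le> extended_gromov_product a x y"
  shows "ereal (c - dist a a') \<le> extended_gromov_product a' x y"
  unfolding le_extended_gromov_product_iff
proof (intro ballI allI impI)
  fix u v c' assume "u \<in> representatives x" "v \<in> representatives y" "c' < c - dist a a'"
  then have "\<forall>\<^sub>F n in sequentially. c' + dist a a' < gromov_product a (u n) (v n)"
    using assms by (auto simp: le_extended_gromov_product_iff)
  then show "\<forall>\<^sub>F n in sequentially. c' < gromov_product a' (u n) (v n)"
    by eventually_elim (use gromov_product_base[of a _ _ a'] in \<open>smt (verit)\<close>)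
qed

lemma extended_gromov_product_isometry:
  assumes "\<And>x y. dist (f x) (f y) = dist x y"
  shows "extended_gromov_product (f a) (map_sum f (boundary_action f) x)
           (map_sum f (boundary_action f) y) = extended_gromov_product a x y"
proof -
  have "representatives (map_sum f (boundary_action f) z) = (\<lambda>u. f \<circ> u) ` representatives z" for z
    by (cases z) (auto simp: boundary_action_def)
  moreover have "{h u v |u v. u \<in> F ` A \<and> v \<in> F ` B} = {h (F u) (F v) |u v. u \<in> A \<and> v \<in> B}"
    for h :: "(nat \<Rightarrow> 'a) \<Rightarrow> (nat \<Rightarrow> 'a) \<Rightarrow> ereal" and F A B
    by blast
  ultimately have pairs:
    "{h u v |u v. u \<in> representatives (map_sum f (boundary_action f) x) \<and>
        v \<in> representatives (map_sum f (boundary_action f) y)} =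
      {h (f \<circ> u) (f \<circ> v) |u v. u \<in> representatives x \<and> v \<in> representatives y}"
    for h :: "(nat \<Rightarrow> 'a) \<Rightarrow> (nat \<Rightarrow> 'a) \<Rightarrow> ereal"
    by simp
  show ?thesis
    unfolding extended_gromov_product_def
    by (simp only: pairs) (simp add: gromov_product_isometry[OF assms])
qed

text \<open>The product is 1-Lipschitz in the interior point. This makes the interior part of the
  set \<open>V\<close> in \<open>neighbourhood_contains_open\<close> open.\<close>

lemma extended_gromov_product_greater_open:
  assumes "ereal r < extended_gromov_product a x (Inl p)"
  shows "\<exists>e>0. \<forall>q. dist q p < e \<longrightarrow> ereal r < extended_gromov_product a x (Inl q)"
proof -
  obtain c where c: "ereal r < ereal c" "ereal c < extended_gromov_product a x (Inl p)"
    using assms ereal_dense2 by blast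
  have "ereal r < extended_gromov_product a x (Inl q)" if "dist q p < (c - r) / 2" for q
  proof -
    have "ereal (c - dist q p) \<le> extended_gromov_product a x (Inl q)"
      unfolding le_extended_gromov_product_iff
    proof (intro ballI allI impI)
      fix u v c' assume u: "u \<in> representatives x" and v: "v \<in> representatives (Inl q)"
        and c': "c' < c - dist q p"
      have "\<forall>\<^sub>F n in sequentially. c' + dist q p < gromov_product a (u n) p"
        using c(2)[THEN less_imp_le] u c' by (auto simp: le_extended_gromov_product_iff)
      then show "\<forall>\<^sub>F n in sequentially. c' < gromov_product a (u n) (v n)"
      proof eventually_elim
        case (elim n)
        have "gromov_product a (u n) p \<le> gromov_product a (u n) q + dist q p"
          using dist_triangle[of a p q] dist_triangle[of "u n" q p]
          by (simp add: gromov_product_def dist_commute field_simps)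
        then show ?case using elim v by simp
      qed
    qed
    moreover have "ereal r < ereal (c - dist q p)"
      using that c(1) by (simp add: field_simps)
    ultimately show ?thesis by (rule less_le_trans[rotated])
  qed
  moreover have "(c - r) / 2 > 0" using c(1) by simp
  ultimately show ?thesis by blast
qed

section \<open>The boundary of a hyperbolic space\<close>

locale hyperbolic_space =
  fixes b :: "'a::metric_space" and \<delta> :: real
  assumes \<delta>_nonneg: "0 \<le> \<delta>"
    and gromov_product_ultra:
      "\<And>a x y z::'a. gromov_product a x z \<ge>
         min (gromov_product a x y) (gromov_product a y z) - \<delta>"
begin

section \<open>Equivalence classes of Gromov sequences\<close>

lemma equiv_gromov_equiv: "equiv {u :: nat \<Rightarrow> 'a. gromov_sequence u} gromov_equiv"
proof (rule equivI)
  show "gromov_equiv \<subseteq> {u :: nat \<Rightarrow> 'a. gromov_sequence u} \<times> {u. gromov_sequence u}"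
    by (auto simp: gromov_equiv_def)
  show "refl_on {u :: nat \<Rightarrow> 'a. gromov_sequence u} gromov_equiv"
  proof (rule refl_onI)
    fix u :: "nat \<Rightarrow> 'a" assume u: "u \<in> {u. gromov_sequence u}"
    have "filterlim (\<lambda>n. gromov_product a (u n) (u n)) at_top sequentially" for a
      unfolding filterlim_at_top
    proof
      fix Z
      obtain N where "\<And>n. n \<ge> N \<Longrightarrow> Z \<le> gromov_product a (u n) (u n)"
        using u gromov_sequenceD[of u Z a] by auto
      then show "\<forall>\<^sub>F n in sequentially. Z \<le> gromov_product a (u n) (u n)"
        by (auto simp: eventually_sequentially)
    qed
    with u show "(u, u) \<in> gromov_equiv" by (auto simp: gromov_equiv_def)
  qed
  show "sym (gromov_equiv :: (nat \<Rightarrow> 'a) rel)"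
  proof (rule symI)
    fix u v :: "nat \<Rightarrow> 'a" assume "(u, v) \<in> gromov_equiv"
    moreover have "(\<lambda>n. gromov_product a (v n) (u n)) = (\<lambda>n. gromov_product a (u n) (v n))" for a
      by (intro ext gromov_product_commute)
    ultimately show "(v, u) \<in> gromov_equiv" by (simp add: gromov_equiv_def)
  qed
  \<comment> \<open>Only here does hyperbolicity enter: the loss of \<delta> is harmless for
    products that tend to infinity.\<close>
  show "trans (gromov_equiv :: (nat \<Rightarrow> 'a) rel)"
  proof (rule transI)
    fix u v w :: "nat \<Rightarrow> 'a" assume uv: "(u, v) \<in> gromov_equiv" and vw: "(v, w) \<in> gromov_equiv"
    have "filterlim (\<lambda>n. gromov_product a (u n) (w n)) at_top sequentially" for a
      unfolding filterlim_at_top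
    proof
      fix Z
      have "\<forall>\<^sub>F n in sequentially. Z + \<delta> \<le> gromov_product a (u n) (v n)"
        "\<forall>\<^sub>F n in sequentially. Z + \<delta> \<le> gromov_product a (v n) (w n)"
        using uv vw by (auto simp: gromov_equiv_def filterlim_at_top)
      then show "\<forall>\<^sub>F n in sequentially. Z \<le> gromov_product a (u n) (w n)"
        by eventually_elim (smt (verit) gromov_product_ultra)
    qed
    with uv vw show "(u, w) \<in> gromov_equiv" by (auto simp: gromov_equiv_def)
  qed
qed

lemma boundary_nonempty: "x \<in> gromov_boundary \<Longrightarrow> \<exists>u::nat \<Rightarrow> 'a. u \<in> x"
  using in_quotient_imp_non_empty[OF equiv_gromov_equiv] by (auto simp: gromov_boundary_def)

lemma boundary_sequence:
  "x \<in> gromov_boundary \<Longrightarrow> u \<in> x \<Longrightarrow> gromov_sequence (u :: nat \<Rightarrow> 'a)"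
  using in_quotient_imp_subset[OF equiv_gromov_equiv] by (auto simp: gromov_boundary_def)

lemma boundary_equiv:
  assumes "x \<in> gromov_boundary" "u \<in> x" "v \<in> x"
  shows "filterlim (\<lambda>n. gromov_product (a::'a) (u n) (v n)) at_top sequentially"
  using quotient_eq_iff[OF equiv_gromov_equiv, of x x u v] assms
  by (auto simp: gromov_boundary_def gromov_equiv_def)

text \<open>The constant is still \<delta>, since one representative \<open>v\<close> of the middle
  point serves both hypotheses at each index. The middle point has to lie in the compactification in
  order to have a representative: over an empty set of representatives both products would be
  \<infinity>.\<close>

lemma ultra:
  assumes "ereal c \<le> extended_gromov_product (a::'a) x y"
    and "ereal c \<le> extended_gromov_product a y z"
    and "y \<in> UNIV <+> gromov_boundary"
  shows "ereal (c - \<delta>) \<le> extended_gromov_product a x z"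
  unfolding le_extended_gromov_product_iff
proof (intro ballI allI impI)
  fix u w c' assume u: "u \<in> representatives x" and w: "w \<in> representatives z" and c': "c' < c - \<delta>"
  obtain v where v: "v \<in> representatives y"
    using assms(3) boundary_nonempty by fastforce
  have "\<forall>\<^sub>F n in sequentially. c' + \<delta> < gromov_product a (u n) (v n)"
    "\<forall>\<^sub>F n in sequentially. c' + \<delta> < gromov_product a (v n) (w n)"
    using assms(1,2) u v w c' by (auto simp: le_extended_gromov_product_iff)
  then show "\<forall>\<^sub>F n in sequentially. c' < gromov_product a (u n) (w n)"
    by eventually_elim (smt (verit) gromov_product_ultra)
qed

lemma ultra_boundary:
  assumes "ereal c \<le> extended_gromov_product (a::'a) (Inr x) y"
    and "ereal c \<le> extended_gromov_product a (Inr x) z" and "x \<in> gromov_boundary"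
  shows "ereal (c - \<delta>) \<le> extended_gromov_product a y z"
  using ultra[of c a y "Inr x" z] assms extended_gromov_product_commute[of a y "Inr x"] by auto

lemma extended_gromov_product_self:
  assumes "x \<in> gromov_boundary"
  shows "ereal c \<le> extended_gromov_product (a::'a) (Inr x) (Inr x)"
  using boundary_equiv[OF assms] by (auto simp: le_extended_gromov_product_iff filterlim_at_top_dense)

text \<open>Were all lower bounds true, representatives of \<open>x\<close> and \<open>y\<close>
  would be equivalent and the two classes would coincide.\<close>

lemma extended_gromov_product_bounded:
  assumes x: "x \<in> gromov_boundary" and y: "y \<in> gromov_boundary" and "x \<noteq> y"
  shows "\<exists>c. \<not> ereal c \<le> extended_gromov_product (a::'a) (Inr x) (Inr y)"
proof (rule ccontr)
  assume "\<not> ?thesis"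
  then have inf: "ereal c \<le> extended_gromov_product a (Inr x) (Inr y)" for c by blast
  obtain u v where u: "u \<in> x" and v: "v \<in> y" using boundary_nonempty x y by metis
  \<comment> \<open>\<open>gromov_equiv\<close> asks for divergence at every base point, hence the
    transfer from \<open>a\<close> to \<open>a'\<close>.\<close>
  have "ereal c \<le> extended_gromov_product a' (Inr x) (Inr y)" for c a'
    using extended_gromov_product_base[OF inf[of "c + dist a a'"], of a'] by simp
  then have "filterlim (\<lambda>n. gromov_product a' (u n) (v n)) at_top sequentially" for a'
    unfolding filterlim_at_top_dense using u v
    by (auto simp: le_extended_gromov_product_iff) (meson gt_ex)
  then have "(u, v) \<in> gromov_equiv"
    using boundary_sequence x y u v by (auto simp: gromov_equiv_def)
  then show False
    using quotient_eq_iff[OF equiv_gromov_equiv] x y u v \<open>x \<noteq> y\<close>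
    by (auto simp: gromov_boundary_def)
qed

text \<open>A late term of any sequence representing \<open>x\<close> will do. The reserve \<delta>
  above \<open>c\<close> pays for the passage to all other representatives of \<open>x\<close>, over
  which the extended product takes the infimum.\<close>

lemma approach_boundary:
  assumes "x \<in> gromov_boundary"
  shows "\<exists>p. ereal c \<le> extended_gromov_product (a::'a) (Inr x) (Inl p)"
proof -
  obtain u where u: "u \<in> x" using boundary_nonempty assms by blast
  obtain N where N: "\<And>m n. m \<ge> N \<Longrightarrow> n \<ge> N \<Longrightarrow> c + \<delta> \<le> gromov_product a (u m) (u n)"
    using gromov_sequenceD[OF boundary_sequence[OF assms u]] by metis
  have "ereal c \<le> extended_gromov_product a (Inr x) (Inl (u N))"
    unfolding le_extended_gromov_product_iff
  proof (intro ballI allI impI)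
    fix v w c' assume v: "v \<in> representatives (Inr x)" and w: "w \<in> representatives (Inl (u N))"
      and "c' < c"
    have "\<forall>\<^sub>F n in sequentially. c + \<delta> \<le> gromov_product a (v n) (u n)"
      using boundary_equiv[OF assms _ u, of v a] v by (auto simp: filterlim_at_top)
    then show "\<forall>\<^sub>F n in sequentially. c' < gromov_product a (v n) (w n)"
      using eventually_ge_at_top[of N]
    proof eventually_elim
      case (elim n)
      then show ?case
        using gromov_product_ultra[where a=a and x="v n" and y="u n" and z="u N"] N[of n N] w \<open>c' < c\<close> by auto
    qed
  qed
  then show ?thesis by blast
qed

text \<open>Instead of proving a superlevel set of the product open, \<open>V\<close> is cut out of
  it by what openness requires: it keeps just those boundary points around which the inequality
  persists on a whole product neighbourhood. Hyperbolicity shows that this property is itself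
  stable.\<close>

lemma neighbourhood_contains_open:
  assumes x: "x \<in> (gromov_boundary :: (nat \<Rightarrow> 'a) set set)"
  shows "\<exists>V. openin gromov_compactification V \<and> Inr x \<in> V \<and>
    (\<forall>z\<in>V. ereal r \<le> extended_gromov_product b (Inr x) z)"
proof -
  let ?E = "extended_gromov_product b"
  define V where "V = Inl ` {p. ereal r < ?E (Inr x) (Inl p)} \<union>
    Inr ` {z \<in> gromov_boundary. \<exists>s. \<forall>w \<in> UNIV <+> gromov_boundary.
       ereal s \<le> ?E (Inr z) w \<longrightarrow> ereal r < ?E (Inr x) w}"
  have "compactification_open V"
    unfolding compactification_open_def
  proof (intro conjI allI impI)
    show "V \<subseteq> UNIV <+> gromov_boundary" by (auto simp: V_def)
    have "Inl -` V = {p. ereal r < ?E (Inr x) (Inl p)}" by (auto simp: V_def)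
    then show "open (Inl -` V)"
      unfolding open_dist using extended_gromov_product_greater_open by auto
    fix \<xi> and a :: 'a assume "Inr \<xi> \<in> V"
    then obtain s where \<xi>: "\<xi> \<in> gromov_boundary"
      and s: "\<And>w. w \<in> UNIV <+> gromov_boundary \<Longrightarrow> ereal s \<le> ?E (Inr \<xi>) w \<Longrightarrow> ereal r < ?E (Inr x) w"
      by (auto simp: V_def)
    \<comment> \<open>\<open>dist a b\<close> pays for moving the base point from \<open>a\<close>
      to \<open>b\<close>, and \<delta> for passing from \<xi> to a boundary point \<zeta> near it,
      which then has the witness \<open>s + \<delta>\<close>.\<close>
    have "z \<in> V" if z: "z \<in> UNIV <+> gromov_boundary"
      and "extended_gromov_product a (Inr \<xi>) z > ereal (s + \<delta> + dist a b)" for z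
    proof -
      have zs: "ereal (s + \<delta>) \<le> ?E (Inr \<xi>) z"
        using extended_gromov_product_base[of "s + \<delta> + dist a b" a "Inr \<xi>" z b] that(2) by simp
      show ?thesis
      proof (cases z)
        case (Inl p)
        have "ereal s \<le> ereal (s + \<delta>)" using \<delta>_nonneg by simp
        then have "ereal s \<le> ?E (Inr \<xi>) z" using zs by (rule order_trans)
        then show ?thesis using s[OF z] Inl by (auto simp: V_def)
      next
        case (Inr \<zeta>)
        have "ereal r < ?E (Inr x) w" if "w \<in> UNIV <+> gromov_boundary"
          "ereal (s + \<delta>) \<le> ?E (Inr \<zeta>) w" for w
          using ultra[OF zs, of w] that Inr z s[of w] by auto
        then show ?thesis using Inr z unfolding V_def by blast
      qed
    qed
    then show "\<exists>R::real. {z \<in> UNIV <+> gromov_boundary. extended_gromov_product a (Inr \<xi>) z > R} \<subseteq> V"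
      by blast
  qed
  moreover have "\<forall>w \<in> UNIV <+> gromov_boundary.
       ereal (r+1) \<le> ?E (Inr x) w \<longrightarrow> ereal r < ?E (Inr x) w"
    by (meson less_ereal.simps(1) less_add_one less_le_trans)
  then have "Inr x \<in> V" using x unfolding V_def by blast
  moreover have "\<forall>z\<in>V. ereal r \<le> ?E (Inr x) z"
  proof
    fix z assume "z \<in> V"
    then show "ereal r \<le> ?E (Inr x) z"
    proof (cases z)
      case (Inr w)
      with \<open>z \<in> V\<close> obtain s where w: "w \<in> gromov_boundary" and
        s: "\<And>w'. w' \<in> UNIV <+> gromov_boundary \<Longrightarrow> ereal s \<le> ?E (Inr w) w' \<Longrightarrow> ereal r < ?E (Inr x) w'"
        by (auto simp: V_def)
      show ?thesis using s[of "Inr w"] extended_gromov_product_self[OF w] w Inr by (simp add: less_imp_le InrI)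
    qed (auto simp: V_def less_imp_le)
  qed
  ultimately show ?thesis
    by (auto simp: openin_gromov_compactification)
qed

text \<open>Turns limits towards \<open>x\<close> into estimates for points with a large product, at
  the fixed base point \<open>b\<close>. In one direction raising \<open>R\<close> by 1 turns a
  strict bound into a weak one; the other needs an open set inside the product
  neighbourhood.\<close>

lemma eventually_tending_to:
  assumes x: "x \<in> (gromov_boundary :: (nat \<Rightarrow> 'a) set set)"
  shows "eventually P (tending_to x) \<longleftrightarrow>
    (\<exists>r. \<forall>p. ereal r \<le> extended_gromov_product b (Inr x) (Inl p) \<longrightarrow> P p)"
proof
  have top: "Inr x \<in> topspace gromov_compactification"
    using x by (auto simp: topspace_gromov_compactification)
  {
    assume "eventually P (tending_to x)"
    then obtain V where V: "openin gromov_compactification V" "Inr x \<in> V" "\<And>p. Inl p \<in> V \<Longrightarrow> P p"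
      unfolding tending_to_def eventually_filtercomap eventually_nhdsin using top by auto
    then obtain R :: real where
      "{z \<in> UNIV <+> gromov_boundary. extended_gromov_product b (Inr x) z > R} \<subseteq> V"
      unfolding openin_gromov_compactification compactification_open_def by meson
    then have "P p" if "ereal (R + 1) \<le> extended_gromov_product b (Inr x) (Inl p)" for p
      using V(3)[of p] that less_le_trans[of "ereal R" "ereal (R+1)"] by (auto simp: subset_iff)
    then show "\<exists>r. \<forall>p. ereal r \<le> extended_gromov_product b (Inr x) (Inl p) \<longrightarrow> P p" by blast
  next
    assume "\<exists>r. \<forall>p. ereal r \<le> extended_gromov_product b (Inr x) (Inl p) \<longrightarrow> P p"
    then obtain r where r: "\<And>p. ereal r \<le> extended_gromov_product b (Inr x) (Inl p) \<Longrightarrow> P p" by blast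
    obtain V where "openin gromov_compactification V" "Inr x \<in> V"
      "\<forall>z\<in>V. ereal r \<le> extended_gromov_product b (Inr x) z"
      using neighbourhood_contains_open[OF x] by blast
    then show "eventually P (tending_to x)"
      unfolding tending_to_def eventually_filtercomap eventually_nhdsin using top r
      by (intro exI[of _ "\<lambda>z. z \<in> V"]) auto
  }
qed

text \<open>An upper limit along the trivial filter would be -\<infinity>, so finiteness rests on
  this.\<close>

lemma tending_to_neq_bot: "x \<in> (gromov_boundary :: (nat \<Rightarrow> 'a) set set) \<Longrightarrow> tending_to x \<noteq> bot"
  using approach_boundary[of x _ b] by (auto simp: trivial_limit_def eventually_tending_to)

section \<open>Neighbourhoods and limits within the boundary\<close>

lemma boundary_openD:
  assumes "openin gromov_boundary_topology V" "x \<in> V"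
  shows "\<exists>r. \<forall>z\<in>gromov_boundary. ereal r \<le> extended_gromov_product (b::'a) (Inr x) (Inr z) \<longrightarrow> z \<in> V"
proof -
  obtain W where W: "openin gromov_compactification W" "V = Inr -` W \<inter> gromov_boundary"
    using assms by (auto simp: gromov_boundary_topology_def openin_pullback_topology)
  then obtain R :: real where
    "{z \<in> UNIV <+> gromov_boundary. extended_gromov_product b (Inr x) z > R} \<subseteq> W"
    using assms unfolding openin_gromov_compactification compactification_open_def by blast
  then have "\<forall>z\<in>gromov_boundary. ereal (R + 1) \<le> extended_gromov_product b (Inr x) (Inr z) \<longrightarrow> z \<in> V"
    using W(2) less_le_trans[of "ereal R" "ereal (R+1)"] by (auto simp: subset_iff)
  then show ?thesis by blast
qed

lemma boundary_open_neighbourhood: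
  assumes "x \<in> gromov_boundary"
  shows "\<exists>V. openin gromov_boundary_topology V \<and> x \<in> V \<and>
    (\<forall>z\<in>V. ereal r \<le> extended_gromov_product (b::'a) (Inr x) (Inr z))"
proof -
  obtain W where W: "openin gromov_compactification W" "Inr x \<in> W"
    "\<forall>z\<in>W. ereal r \<le> extended_gromov_product b (Inr x) z"
    using neighbourhood_contains_open[OF assms] by blast
  then show ?thesis
    unfolding gromov_boundary_topology_def openin_pullback_topology using assms
    by (intro exI[of _ "Inr -` W \<inter> gromov_boundary"]) auto
qed

lemma limitin_boundary:
  assumes x: "x \<in> gromov_boundary" and f: "\<And>n. f n \<in> gromov_boundary"
  shows "limitin gromov_boundary_topology f x F \<longleftrightarrow>
    (\<forall>r. \<forall>\<^sub>F n in F. ereal r \<le> extended_gromov_product (b::'a) (Inr x) (Inr (f n)))"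
proof
  assume L: "limitin gromov_boundary_topology f x F"
  show "\<forall>r. \<forall>\<^sub>F n in F. ereal r \<le> extended_gromov_product b (Inr x) (Inr (f n))"
  proof
    fix r
    obtain V where "openin gromov_boundary_topology V" "x \<in> V"
      "\<forall>z\<in>V. ereal r \<le> extended_gromov_product b (Inr x) (Inr z)"
      using boundary_open_neighbourhood[OF x] by blast
    then show "\<forall>\<^sub>F n in F. ereal r \<le> extended_gromov_product b (Inr x) (Inr (f n))"
      using L unfolding limitin_def by (metis (no_types, lifting) eventually_mono)
  qed
next
  assume R: "\<forall>r. \<forall>\<^sub>F n in F. ereal r \<le> extended_gromov_product b (Inr x) (Inr (f n))"
  show "limitin gromov_boundary_topology f x F"
    unfolding limitin_def
  proof (intro conjI allI impI)
    show "x \<in> topspace gromov_boundary_topology"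
      using x by (simp add: topspace_gromov_boundary_topology)
    fix V assume "openin gromov_boundary_topology V \<and> x \<in> V"
    then obtain r where r: "\<forall>z\<in>gromov_boundary.
        ereal r \<le> extended_gromov_product b (Inr x) (Inr z) \<longrightarrow> z \<in> V"
      using boundary_openD by blast
    show "\<forall>\<^sub>F n in F. f n \<in> V"
      using R[rule_format, of r] by eventually_elim (use f r in blast)
  qed
qed

end

section \<open>Coarsely additive potentials\<close>

lemma geodesic_segment_reverse:
  assumes "geodesic_segment p q S"
  shows "geodesic_segment q p S"
proof -
  obtain c where c: "c 0 = p" "c (dist p q) = q"
    "\<forall>s\<in>{0..dist p q}. \<forall>t\<in>{0..dist p q}. dist (c s) (c t) = \<bar>s - t\<bar>" "S = c ` {0..dist p q}"
    using assms by (auto simp: geodesic_segment_def)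
  have "S = (\<lambda>t. c (dist p q - t)) ` {0..dist p q}"
    unfolding c(4) image_image[of c "\<lambda>t. dist p q - t", symmetric] by simp
  with c show ?thesis
    unfolding geodesic_segment_def
    by (intro exI[of _ "\<lambda>t. c (dist p q - t)"]) (auto simp: dist_commute[of q p])
qed

lemma coarsely_additive_potential_reverse:
  assumes "coarsely_additive_potential \<psi>"
  shows "coarsely_additive_potential (\<lambda>p q. \<psi> q p)"
proof -
  have swap: "(\<lambda>(p, q). h q p) ` {(p, q). P (dist p q)} = (\<lambda>(p, q). h p q) ` {(p, q). P (dist p q)}"
    for h :: "'a \<Rightarrow> 'a \<Rightarrow> ereal" and P
    by (auto simp: image_iff dist_commute)
  have 1: "(INF (p, q) \<in> {(p, q). dist p q \<ge> r}. ereal (\<psi> q p)) =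
      (INF (p, q) \<in> {(p, q). dist p q \<ge> r}. ereal (\<psi> p q))" for r
    using swap[of "\<lambda>p q. ereal (\<psi> p q)" "\<lambda>t. t \<ge> r"] by simp
  have 2: "(SUP (p, q) \<in> {(p, q). dist p q \<le> r}. ereal \<bar>\<psi> q p\<bar>) =
      (SUP (p, q) \<in> {(p, q). dist p q \<le> r}. ereal \<bar>\<psi> p q\<bar>)" for r
    using swap[of "\<lambda>p q. ereal \<bar>\<psi> p q\<bar>" "\<lambda>t. t \<le> r"] by simp
  show ?thesis
    using assms unfolding coarsely_additive_potential_def 1 2
    by (metis (no_types, lifting) add.commute geodesic_segment_reverse)
qed

text \<open>The lower estimate goes through the lower limit and so needs a nontrivial
  filter.\<close>

lemma Limsup_near_constant:
  fixes f :: "'b \<Rightarrow> real"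
  assumes "F \<noteq> bot" and "\<forall>\<^sub>F p in F. \<bar>f p - c\<bar> \<le> k"
  shows "\<bar>Limsup F (\<lambda>p. ereal (f p))\<bar> \<noteq> \<infinity> \<and> \<bar>real_of_ereal (Limsup F (\<lambda>p. ereal (f p))) - c\<bar> \<le> k"
proof -
  have "Limsup F (\<lambda>p. ereal (f p)) \<le> ereal (c + k)"
    by (rule Limsup_bounded) (use assms(2) in eventually_elim, auto)
  moreover have "ereal (c - k) \<le> Liminf F (\<lambda>p. ereal (f p))"
    by (rule Liminf_bounded) (use assms(2) in eventually_elim, auto)
  then have "ereal (c - k) \<le> Limsup F (\<lambda>p. ereal (f p))"
    using Liminf_le_Limsup[OF assms(1)] order_trans by blast
  ultimately show ?thesis
    by (cases "Limsup F (\<lambda>p. ereal (f p))") auto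
qed

locale potential_space = hyperbolic_space b \<delta> for b :: "'a::metric_space" and \<delta> +
  fixes \<psi> :: "'a \<Rightarrow> 'a \<Rightarrow> real"
  assumes geodesic: "geodesic_space TYPE('a)"
    and potential: "coarsely_additive_potential \<psi>"
begin

lemma point_on_geodesic:
  assumes "0 \<le> t" "t \<le> dist p (q :: 'a)"
  shows "\<exists>S u. geodesic_segment p q S \<and> u \<in> S \<and> dist p u = t \<and> dist u q = dist p q - t"
proof -
  obtain c where c: "c 0 = p" "c (dist p q) = q"
    "\<forall>s\<in>{0..dist p q}. \<forall>t\<in>{0..dist p q}. dist (c s) (c t) = \<bar>s - t\<bar>"
    and g: "geodesic_segment p q (c ` {0..dist p q})"
    using geodesic unfolding geodesic_space_def geodesic_segment_def by metis
  have "dist (c 0) (c t) = t" "dist (c t) (c (dist p q)) = dist p q - t"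
    using c(3) assms by auto
  with c g assms show ?thesis
    by (intro exI[of _ "c ` {0..dist p q}"] exI[of _ "c t"]) auto
qed

text \<open>In a hyperbolic space the product at \<open>u\<close> bounds, up to 2\<delta>, the
  distance from \<open>u\<close> to a geodesic from \<open>p\<close> to \<open>q\<close>. Condition
  (3) thus becomes a numerical hypothesis without geodesics, the form in which it is applied
  below.\<close>

lemma additive_if_gromov_product_le:
  "\<exists>\<kappa>>0. \<forall>p q u. gromov_product u p q \<le> c \<longrightarrow> \<bar>\<psi> p q - (\<psi> p u + \<psi> u q)\<bar> \<le> \<kappa>"
proof -
  \<comment> \<open>The absolute value keeps \<open>r\<close> positive; the 1 makes the bound on
    \<open>dist u w\<close> strict.\<close>
  define r where "r = \<bar>c\<bar> + 2 * \<delta> + 1"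
  have "r > 0" using \<delta>_nonneg by (simp add: r_def)
  then have "\<exists>\<kappa>>0. \<forall>p q u S. geodesic_segment p q S \<and> (\<exists>w\<in>S. dist u w < r) \<longrightarrow>
      \<bar>\<psi> p q - (\<psi> p u + \<psi> u q)\<bar> \<le> \<kappa>"
    using potential by (simp add: coarsely_additive_potential_def)
  then obtain \<kappa> where \<kappa>: "\<kappa> > 0" "\<forall>p q u S. geodesic_segment p q S \<and> (\<exists>w\<in>S. dist u w < r) \<longrightarrow>
        \<bar>\<psi> p q - (\<psi> p u + \<psi> u q)\<bar> \<le> \<kappa>"
    by blast
  have "\<bar>\<psi> p q - (\<psi> p u + \<psi> u q)\<bar> \<le> \<kappa>" if "gromov_product u p q \<le> c" for p q u
  proof -
    \<comment> \<open>\<open>w\<close> is the point of the geodesic that faces \<open>u\<close> in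
      the comparison tripod of \<open>p\<close>, \<open>q\<close> and \<open>u\<close>.\<close>
    define s where "s = gromov_product p u q"
    obtain S w where S: "geodesic_segment p q S" "w \<in> S" and w: "dist p w = s" "dist w q = dist p q - s"
      using point_on_geodesic[OF gromov_product_nonneg[of p u q] gromov_product_le_dist(2)]
      unfolding s_def by blast
    have "gromov_product p q w = s"
      using w by (simp add: gromov_product_def dist_commute)
    then have "s - \<delta> \<le> gromov_product p u w"
      using gromov_product_ultra[where a=p and x=u and y=q and z=w] s_def by simp
    then have "dist u w \<le> gromov_product u p q + 2 * \<delta>"
      using w(1) by (simp add: s_def gromov_product_def dist_commute field_simps)
    then have "dist u w < r" using that by (simp add: r_def)
    with S show ?thesis using \<kappa>(2) by blast
  qed
  with \<kappa>(1) show ?thesis by blast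
qed

text \<open>
  Some point \<open>u\<close> of a geodesic from \<open>e\<close> to \<open>p\<close> is close to every geodesic joining \<open>e\<close> or
  \<open>e'\<close> to \<open>p\<close> or \<open>p'\<close>; additivity at \<open>u\<close> makes the double difference cancel.
\<close>

lemma double_difference_bounded:
  "\<exists>k\<ge>0. \<forall>e e' p p'. gromov_product e p e' + 2 * \<delta> + 1 \<le> gromov_product e p p' \<longrightarrow>
     \<bar>(\<psi> e' p - \<psi> e p) - (\<psi> e' p' - \<psi> e p')\<bar> \<le> k"
proof -
  obtain \<kappa> where \<kappa>: "\<kappa> > 0" and add: "\<And>p q u. gromov_product u p q \<le> 2 * \<delta> \<Longrightarrow>
      \<bar>\<psi> p q - (\<psi> p u + \<psi> u q)\<bar> \<le> \<kappa>"
    using additive_if_gromov_product_le[of "2 * \<delta>"] by blast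
  have "\<bar>(\<psi> e' p - \<psi> e p) - (\<psi> e' p' - \<psi> e p')\<bar> \<le> 4 * \<kappa>"
    if *: "gromov_product e p e' + 2 * \<delta> + 1 \<le> gromov_product e p p'" for e e' p p'
  proof -
    \<comment> \<open>\<open>u\<close> is placed past the point where \<open>e'\<close> branches off
      the geodesic from \<open>e\<close> to \<open>p\<close>, yet, by the hypothesis, not past the
      point where \<open>p'\<close> does. The margin 2\<delta> + 1 ensures that in
      \<open>pe'\<close> and \<open>ue'2\<close> the minimum in the hyperbolic inequality is the
      product with \<open>e'\<close>.\<close>
    define t where "t = gromov_product e p e' + 2 * \<delta> + 1"
    have "0 \<le> t" using gromov_product_nonneg[of e p e'] \<delta>_nonneg by (simp add: t_def)
    moreover have "t \<le> dist e p" using * gromov_product_le_dist(1)[of e p p'] t_def by simp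
    ultimately obtain u where u: "dist e u = t" "dist u p = dist e p - t"
      using point_on_geodesic by meson
    note sym = gromov_product_commute[of e]
    have up: "gromov_product e p u = t"
      using u by (simp add: gromov_product_def dist_commute)
    have up': "t - \<delta> \<le> gromov_product e p' u"
      using gromov_product_ultra[where a=e and x=p' and y=p and z=u] * up sym[of p' p] by (simp add: t_def)
    have ue': "gromov_product e p e' - \<delta> \<le> gromov_product e u e'"
      using gromov_product_ultra[where a=e and x=u and y=p and z=e'] up sym[of u p] \<delta>_nonneg
      by (simp add: t_def)
    have pe': "gromov_product e p' e' \<le> gromov_product e p e' + \<delta>"
      using gromov_product_ultra[where a=e and x=p and y=p' and z=e'] * \<delta>_nonneg by simp
    have ue'2: "gromov_product e p' e' - \<delta> \<le> gromov_product e u e'"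
      using gromov_product_ultra[where a=e and x=u and y=p' and z=e'] up' pe' sym[of u p'] \<delta>_nonneg
      by (simp add: t_def)
    have "gromov_product u e p = 0"
      using u by (simp add: gromov_product_def dist_commute)
    moreover have "gromov_product u e p' \<le> \<delta>"
      using up' u by (simp add: gromov_product_def dist_commute field_simps)
    moreover have "gromov_product u e' p \<le> \<delta>"
      using ue' u by (simp add: gromov_product_def dist_commute field_simps)
    moreover have "gromov_product u e' p' \<le> 2 * \<delta>"
      using ue'2 up' u by (simp add: gromov_product_def dist_commute field_simps)
    ultimately show ?thesis
      using add[of u e p] add[of u e p'] add[of u e' p] add[of u e' p'] \<delta>_nonneg
      by (simp add: abs_le_iff)
  qed
  with \<kappa> show ?thesis by (intro exI[of _ "4 * \<kappa>"]) simp
qed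

section \<open>Lower bounds and growth of the potential\<close>

lemma potential_bounded_below: "\<exists>m\<ge>0. \<forall>p q. - m \<le> \<psi> p q"
proof -
  have "((\<lambda>r::real. INF (p, q) \<in> {(p, q). dist p q \<ge> r}. ereal (\<psi> p q)) \<longlongrightarrow> \<infinity>) at_top"
    using potential by (simp add: coarsely_additive_potential_def)
  then have "\<forall>\<^sub>F r::real in at_top. ereal 0 < (INF (p, q) \<in> {(p, q). dist p q \<ge> r}. ereal (\<psi> p q))"
    unfolding tendsto_PInfty by blast
  then obtain r :: real where r: "r > 0"
    "ereal 0 < (INF (p, q) \<in> {(p, q). dist p q \<ge> r}. ereal (\<psi> p q))"
    unfolding eventually_at_top_linorder by (metis gt_ex le_less_linear less_imp_le less_le_trans)
  have far: "0 \<le> \<psi> p q" if "r \<le> dist p q" for p q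
  proof -
    have "(INF (p, q) \<in> {(p, q). dist p q \<ge> r}. ereal (\<psi> p q)) \<le> ereal (\<psi> p q)"
      by (rule INF_lower2[of "(p, q)"]) (use that in auto)
    with r(2) have "ereal 0 < ereal (\<psi> p q)" by (rule less_le_trans)
    then show ?thesis by simp
  qed
  let ?S = "SUP (p, q) \<in> {(p, q). dist p q \<le> r}. ereal \<bar>\<psi> p q\<bar>"
  have "?S < \<infinity>" using potential r(1) by (simp add: coarsely_additive_potential_def)
  then obtain m where m: "?S \<le> ereal m" by (cases ?S) auto
  have near: "\<bar>\<psi> p q\<bar> \<le> m" if "dist p q \<le> r" for p q
  proof -
    have "ereal \<bar>\<psi> p q\<bar> \<le> ?S"
      by (rule SUP_upper2[of "(p, q)"]) (use that in auto)
    then have "ereal \<bar>\<psi> p q\<bar> \<le> ereal m" using m by (rule order_trans)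
    then show ?thesis by simp
  qed
  have "0 \<le> m" using near[of b b] r(1) by simp
  moreover have "- m \<le> \<psi> p q" for p q
    using near[of p q] far[of p q] \<open>0 \<le> m\<close> by (cases "dist p q \<le> r") auto
  ultimately show ?thesis by blast
qed

lemma potential_tends_to_infinity:
  assumes "filterlim (\<lambda>n. dist (p n) (q n :: 'a)) at_top F"
  shows "filterlim (\<lambda>n. \<psi> (p n) (q n)) at_top F"
  unfolding filterlim_at_top
proof
  fix Z
  have "((\<lambda>r::real. INF (p, q) \<in> {(p, q). dist p q \<ge> r}. ereal (\<psi> p q)) \<longlongrightarrow> \<infinity>) at_top"
    using potential by (simp add: coarsely_additive_potential_def)
  then have "\<forall>\<^sub>F r::real in at_top. ereal Z < (INF (p, q) \<in> {(p, q). dist p q \<ge> r}. ereal (\<psi> p q))"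
    unfolding tendsto_PInfty by blast
  then obtain r where r: "ereal Z < (INF (p, q) \<in> {(p, q). dist p q \<ge> r}. ereal (\<psi> p q))"
    unfolding eventually_at_top_linorder by blast
  have "\<forall>\<^sub>F n in F. r \<le> dist (p n) (q n)"
    using assms by (simp add: filterlim_at_top)
  then show "\<forall>\<^sub>F n in F. Z \<le> \<psi> (p n) (q n)"
  proof eventually_elim
    case (elim n)
    have "(INF (p, q) \<in> {(p, q). dist p q \<ge> r}. ereal (\<psi> p q)) \<le> ereal (\<psi> (p n) (q n))"
      by (rule INF_lower2[of "(p n, q n)"]) (use elim in auto)
    with r have "ereal Z < ereal (\<psi> (p n) (q n))" by (rule less_le_trans)
    then show ?case by simp
  qed
qed

text \<open>The point \<open>u\<close> of a geodesic from \<open>p\<close> to \<open>q\<close> that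
  faces \<open>b\<close> is close to geodesics from \<open>p\<close> to \<open>b\<close> and from
  \<open>b\<close> to \<open>q\<close> as well. Splitting all three terms at \<open>u\<close> leaves
  \<psi>(u, b) + \<psi>(b, u), up to three additivity errors, and the potential is bounded
  below.\<close>

lemma triangle_defect_bounded_below:
  "\<exists>m. \<forall>p q. m \<le> \<psi> p b + \<psi> b q - \<psi> p q"
proof -
  obtain \<kappa> where \<kappa>: "\<kappa> > 0" and add: "\<And>p q u. gromov_product u p q \<le> \<delta> \<Longrightarrow>
      \<bar>\<psi> p q - (\<psi> p u + \<psi> u q)\<bar> \<le> \<kappa>"
    using additive_if_gromov_product_le[of \<delta>] by blast
  obtain m where m: "\<And>p q. - m \<le> \<psi> p q" using potential_bounded_below by blast
  have "- 2 * m - 3 * \<kappa> \<le> \<psi> p b + \<psi> b q - \<psi> p q" for p q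
  proof -
    define s where "s = gromov_product p b q"
    obtain u where u: "dist p u = s" "dist u q = dist p q - s"
      using point_on_geodesic[OF gromov_product_nonneg[of p b q] gromov_product_le_dist(2)]
      unfolding s_def by blast
    have "gromov_product p q u = s"
      using u by (simp add: gromov_product_def dist_commute)
    then have "s - \<delta> \<le> gromov_product p b u"
      using gromov_product_ultra[where a=p and x=b and y=q and z=u] s_def by simp
    then have bu: "dist b u \<le> gromov_product b p q + 2 * \<delta>"
      using u(1) by (simp add: s_def gromov_product_def dist_commute field_simps)
    have "gromov_product u p q \<le> \<delta>"
      using u \<delta>_nonneg by (simp add: gromov_product_def dist_commute)
    moreover have "gromov_product u p b \<le> \<delta>"
      using u bu by (simp add: s_def gromov_product_def dist_commute field_simps)
    moreover have "gromov_product u b q \<le> \<delta>"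
      using u bu by (simp add: s_def gromov_product_def dist_commute field_simps)
    ultimately show ?thesis
      using add[of u p q] add[of u p b] add[of u b q] m[of u b] m[of b u]
      by (simp add: abs_le_iff)
  qed
  then show ?thesis by blast
qed

end

section \<open>Dynamics of convergence actions\<close>

lemma limitin_embedding_map:
  assumes "embedding_map X Y f" and "\<And>n. g n \<in> topspace X" and "x \<in> topspace X"
  shows "limitin Y (\<lambda>n. f (g n)) (f x) F \<longleftrightarrow> limitin X g x F"
proof
  assume L: "limitin Y (\<lambda>n. f (g n)) (f x) F"
  obtain h where h: "homeomorphic_maps X (subtopology Y (f ` topspace X)) f h"
    using assms(1) by (auto simp: embedding_map_def homeomorphic_map_maps)
  have "limitin (subtopology Y (f ` topspace X)) (\<lambda>n. f (g n)) (f x) F"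
    unfolding limitin_subtopology using L assms(2,3) by (simp add: always_eventually)
  moreover have "continuous_map (subtopology Y (f ` topspace X)) X h"
    using h by (simp add: homeomorphic_maps_def)
  ultimately have "limitin X (h \<circ> (\<lambda>n. f (g n))) (h (f x)) F"
    by (rule continuous_map_limit[rotated])
  moreover have "h (f z) = z" if "z \<in> topspace X" for z
    using h that by (auto simp: homeomorphic_maps_def)
  ultimately show "limitin X g x F" using assms by (simp add: o_def)
next
  assume "limitin X g x F"
  then have "limitin Y (f \<circ> g) (f x) F"
    using homeomorphic_imp_continuous_map[OF assms(1)[unfolded embedding_map_def]]
    by (simp add: continuous_map_in_subtopology continuous_map_limit)
  then show "limitin Y (\<lambda>n. f (g n)) (f x) F" by (simp add: o_def)
qed

lemma loc_unif_const_subseq: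
  assumes "loc_unif_const M f y x" "strict_mono r"
  shows "loc_unif_const M (\<lambda>n. f (r n)) y x"
  unfolding loc_unif_const_def
proof
  fix z assume "z \<in> topspace M - {y}"
  then obtain V where V: "openin (subtopology M (topspace M - {y})) V" "z \<in> V"
    "\<And>U. openin M U \<and> x \<in> U \<Longrightarrow> \<forall>\<^sub>F n in sequentially. f n ` V \<subseteq> U"
    using assms(1) unfolding loc_unif_const_def by metis
  then show "\<exists>V. openin (subtopology M (topspace M - {y})) V \<and> z \<in> V \<and>
        (\<forall>U. openin M U \<and> x \<in> U \<longrightarrow> (\<forall>\<^sub>F n in sequentially. f (r n) ` V \<subseteq> U))"
    using eventually_subseq[OF assms(2)] by blast
qed

lemma loc_unif_const_limitin:
  assumes "loc_unif_const M f y x" "z \<in> topspace M" "z \<noteq> y" "x \<in> topspace M"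
  shows "limitin M (\<lambda>n. f n z) x sequentially"
proof -
  obtain V where V: "z \<in> V" "\<And>U. openin M U \<and> x \<in> U \<Longrightarrow> \<forall>\<^sub>F n in sequentially. f n ` V \<subseteq> U"
    using assms unfolding loc_unif_const_def by (metis DiffI singletonD)
  have "\<forall>\<^sub>F n in sequentially. f n z \<in> U" if "openin M U" "x \<in> U" for U
    using V(2)[OF conjI[OF that]] by eventually_elim (use V(1) in blast)
  then show ?thesis using assms(4) by (auto simp: limitin_def)
qed

text \<open>The complement of \<open>W\<close> is compact and avoids \<open>y\<close>, so finitely
  many of the local sets cover it.\<close>

lemma loc_unif_const_uniform:
  assumes "loc_unif_const M f y x" "compact_space M" "openin M W" "y \<in> W" "openin M U" "x \<in> U"
  shows "\<forall>\<^sub>F n in sequentially. f n ` (topspace M - W) \<subseteq> U"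
proof -
  let ?S = "subtopology M (topspace M - {y})"
  have "compactin M (topspace M - W)"
    using assms(2,3) closedin_compact_space by blast
  then have K: "compactin ?S (topspace M - W)"
    using assms(4) by (auto simp: compactin_subtopology)
  have "\<forall>z \<in> topspace M - W. \<exists>V. openin ?S V \<and> z \<in> V \<and> (\<forall>\<^sub>F n in sequentially. f n ` V \<subseteq> U)"
    using assms(1,4,5,6) unfolding loc_unif_const_def by (metis Diff_iff empty_iff insert_iff)
  then obtain V where V: "\<And>z. z \<in> topspace M - W \<Longrightarrow> openin ?S (V z)"
    "\<And>z. z \<in> topspace M - W \<Longrightarrow> z \<in> V z"
    "\<And>z. z \<in> topspace M - W \<Longrightarrow> \<forall>\<^sub>F n in sequentially. f n ` V z \<subseteq> U"
    by metis
  have "\<exists>\<F>. finite \<F> \<and> \<F> \<subseteq> V ` (topspace M - W) \<and> topspace M - W \<subseteq> \<Union>\<F>"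
    using compactinD[OF K, of "V ` (topspace M - W)"] V(1,2) by blast
  then obtain \<F> where F: "finite \<F>" "\<F> \<subseteq> V ` (topspace M - W)" "topspace M - W \<subseteq> \<Union>\<F>"
    by blast
  then obtain Z where Z: "finite Z" "Z \<subseteq> topspace M - W" "topspace M - W \<subseteq> \<Union>(V ` Z)"
    using finite_subset_image[OF F(1,2)] by blast
  have "\<forall>\<^sub>F n in sequentially. \<forall>z\<in>Z. f n ` V z \<subseteq> U"
    using Z V(3) by (intro eventually_ball_finite) auto
  then show ?thesis
    by eventually_elim (use Z(3) in blast)
qed

lemma inj_subseq: "inj \<gamma> \<Longrightarrow> strict_mono r \<Longrightarrow> inj (\<lambda>n. \<gamma> (r n))" for r :: "nat \<Rightarrow> nat"
  using inj_compose[OF _ strict_mono_imp_inj_on, of \<gamma> r] by (simp add: o_def)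

text \<open>Extraction with a changing condition: the k-th chosen index has to satisfy the k-th
  property only.\<close>

lemma strict_mono_choice:
  assumes "\<And>k. \<exists>\<^sub>F n in sequentially. P k (n::nat)"
  shows "\<exists>s. strict_mono s \<and> (\<forall>k::nat. P k (s k))"
proof -
  have "\<exists>n>m. P k n" for k m
    using assms[of k] by (auto simp: frequently_sequentially) (meson Suc_le_lessD)
  then have "\<exists>s. \<forall>k. P k (s k) \<and> s k < s (Suc k)"
    by (intro dependent_nat_choice) blast+
  then show ?thesis by (auto simp: strict_mono_Suc_iff)
qed

text \<open>\<open>three_points\<close> is the form in which non-elementarity is used. Its
  \<open>x\<close> and \<open>y\<close> may be any values, also outside the space, so that
  projections of arbitrary points of the compactification can be avoided too.\<close>

locale compactified_group = group G
  for G :: "'g monoid" (structure) +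
  fixes M :: "'m topology" and \<phi> :: "'g \<Rightarrow> 'm \<Rightarrow> 'm" and d
  assumes compatible: "compatible_metric G M \<phi> d"
    and three_points: "\<And>x y. \<exists>z\<in>topspace M. z \<noteq> x \<and> z \<noteq> y"
begin

sublocale Metric_space "carrier G <+> topspace M" d
  using compatible by (simp add: compatible_metric_def)

lemma eventually_in_mball:
  assumes "limitin mtopology f x F" "0 < r"
  shows "\<forall>\<^sub>F n in F. f n \<in> mball x r"
proof -
  have "x \<in> mball x r" using assms limitin_topspace by fastforce
  then show ?thesis using assms(1) openin_mball unfolding limitin_def by blast
qed

abbreviation act :: "'g \<Rightarrow> 'g + 'm \<Rightarrow> 'g + 'm" where
  "act g \<equiv> map_sum (\<lambda>h. g \<otimes> h) (\<phi> g)"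

lemma compact: "compact_space mtopology"
  and embedding_Inl: "embedding_map (discrete_topology (carrier G)) mtopology Inl"
  and embedding_Inr: "embedding_map M mtopology Inr"
  and convergence: "convergence_action G mtopology act"
  using compatible by (simp_all add: compatible_metric_def Let_def)

lemma group_action_act:
  "group_action G (carrier G <+> topspace M) (\<lambda>g. restrict (act g) (carrier G <+> topspace M))"
  using convergence by (simp add: convergence_action_def)

lemma act_closed:
  "g \<in> carrier G \<Longrightarrow> z \<in> carrier G <+> topspace M \<Longrightarrow> act g z \<in> carrier G <+> topspace M"
  using group_action.element_image[OF group_action_act, of g z] by simp

lemma boundary_closed: "g \<in> carrier G \<Longrightarrow> x \<in> topspace M \<Longrightarrow> \<phi> g x \<in> topspace M"
  using act_closed[of g "Inr x"] by auto

lemma act_mult: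
  "g \<in> carrier G \<Longrightarrow> h \<in> carrier G \<Longrightarrow> z \<in> carrier G <+> topspace M \<Longrightarrow>
     act (g \<otimes> h) z = act g (act h z)"
  using group_action.composition_rule[OF group_action_act, of z g h] act_closed[of h z] by simp

lemma act_one: "z \<in> carrier G <+> topspace M \<Longrightarrow> act \<one> z = z"
  using group_action.id_eq_one[OF group_action_act] by (metis restrict_apply')

lemma boundary_mult:
  "g \<in> carrier G \<Longrightarrow> h \<in> carrier G \<Longrightarrow> x \<in> topspace M \<Longrightarrow> \<phi> (g \<otimes> h) x = \<phi> g (\<phi> h x)"
  using act_mult[of g h "Inr x"] by auto

text \<open>Group elements are isolated. If \<open>x\<close> were one of them, \<gamma> n h would
  eventually equal it for some h other than \<open>y\<close>, and cancelling h would make \<gamma>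
  eventually constant.\<close>

lemma limit_in_boundary:
  assumes \<gamma>: "inj \<gamma>" "range \<gamma> \<subseteq> carrier G"
    and x: "x \<in> carrier G <+> topspace M" and conv: "loc_unif_const mtopology (\<lambda>n. act (\<gamma> n)) y x"
  shows "x \<in> Inr ` topspace M"
proof (rule ccontr)
  assume "x \<notin> Inr ` topspace M"
  with x obtain g where g: "g \<in> carrier G" "x = Inl g" by auto
  have "openin (subtopology mtopology (Inl ` carrier G)) (Inl ` {g})"
    using homeomorphic_imp_open_map[OF embedding_Inl[unfolded embedding_map_def]] g(1)
    unfolding open_map_def by (metis empty_subsetI insert_subset openin_discrete_topology topspace_discrete_topology)
  then obtain U where U: "openin mtopology U" "Inl ` {g} = U \<inter> Inl ` carrier G"
    unfolding openin_subtopology by blast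
  \<comment> \<open>Injectivity gives two group elements, at least one of which is not
    \<open>y\<close>.\<close>
  have "\<gamma> 0 \<noteq> \<gamma> 1" using \<gamma>(1) by (metis injD zero_neq_one)
  then obtain h where h: "h \<in> carrier G" "Inl h \<noteq> y"
    using \<gamma>(2) by (metis range_subsetD sum.inject(1))
  have "limitin mtopology (\<lambda>n. act (\<gamma> n) (Inl h)) x sequentially"
    using loc_unif_const_limitin[OF conv, of "Inl h"] h x by auto
  then have "\<forall>\<^sub>F n in sequentially. act (\<gamma> n) (Inl h) \<in> U"
    using U g by (auto simp: limitin_def)
  then have "\<forall>\<^sub>F n in sequentially. \<gamma> n \<otimes> h = g"
  proof eventually_elim
    case (elim n)
    then have "Inl (\<gamma> n \<otimes> h) \<in> U \<inter> Inl ` carrier G"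
      using \<gamma>(2) h(1) by auto
    then show ?case unfolding U(2)[symmetric] by simp
  qed
  then obtain N where "\<gamma> N \<otimes> h = g" "\<gamma> (Suc N) \<otimes> h = g"
    unfolding eventually_sequentially by (meson le_SucI order_refl)
  then have "\<gamma> N = \<gamma> (Suc N)"
    using \<gamma>(2) h(1) by (metis range_subsetD right_cancel)
  then show False using \<gamma>(1) by (meson injD n_not_Suc_n)
qed

text \<open>If \<open>y\<close> and \<open>x'\<close> differed, the points \<open>g n z\<close> with
  \<open>z\<close> other than \<open>y'\<close> would end up near \<open>x'\<close>, hence away from
  \<open>y\<close>, where \<open>f\<close> contracts to \<open>x\<close>. Thus
  \<open>z = f n (g n z)\<close> would be \<open>x\<close>, leaving at most the two points
  \<open>x\<close> and \<open>y'\<close>.\<close>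

lemma repelling_eq_limit_of_inverses:
  assumes f: "loc_unif_const mtopology f y x" and g: "loc_unif_const mtopology g y' x'"
    and pts: "x \<in> carrier G <+> topspace M" "y \<in> carrier G <+> topspace M" "x' \<in> carrier G <+> topspace M"
    and inv: "\<And>n z. z \<in> carrier G <+> topspace M \<Longrightarrow> g n z \<in> carrier G <+> topspace M \<and> f n (g n z) = z"
  shows "y = x'"
proof (rule ccontr)
  assume "y \<noteq> x'"
  define r where "r = d y x' / 2"
  have "r > 0" using \<open>y \<noteq> x'\<close> pts by (simp add: r_def)
  have "z = x" if z: "z \<in> carrier G <+> topspace M" "z \<noteq> y'" for z
  proof (rule ccontr)
    assume "z \<noteq> x"
    then have dz: "d x z > 0" using pts z by simp
    have "limitin mtopology (\<lambda>n. g n z) x' sequentially"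
      using loc_unif_const_limitin[OF g] z pts by simp
    then have 1: "\<forall>\<^sub>F n in sequentially. g n z \<in> mball x' r"
      using \<open>r > 0\<close> by (rule eventually_in_mball)
    have 2: "\<forall>\<^sub>F n in sequentially. f n ` (carrier G <+> topspace M - mball y r) \<subseteq> mball x (d x z)"
      using loc_unif_const_uniform[OF f compact, of "mball y r" "mball x (d x z)"] \<open>r > 0\<close> dz pts by simp
    have "\<forall>\<^sub>F n in sequentially. False"
      using 1 2
    proof eventually_elim
      case (elim n)
      have "g n z \<notin> mball y r"
        using elim(1) triangle[of y "g n z" x'] commute[of "g n z" x'] pts inv[OF z(1), of n]
        by (simp add: r_def)
      then have "g n z \<in> carrier G <+> topspace M - mball y r"
        using inv[OF z(1), of n] by simp
      then have "f n (g n z) \<in> mball x (d x z)"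
        using elim(2) unfolding image_subset_iff by (rule bspec[rotated])
      then show False using inv[OF z(1), of n] by simp
    qed
    then show False by simp
  qed
  \<comment> \<open>If \<open>x\<close> or \<open>y'\<close> is a group element, its
    \<open>projr\<close> is an arbitrary value, and \<open>Inr z\<close> differs from the point
    anyway.\<close>
  moreover obtain z where "z \<in> topspace M" "z \<noteq> projr x" "z \<noteq> projr y'"
    using three_points by blast
  then have "Inr z \<in> carrier G <+> topspace M" "Inr z \<noteq> x" "Inr z \<noteq> y'" by auto
  ultimately show False by blast
qed

text \<open>Extract for \<gamma>, then for the inverses of that subsequence. The repelling point of
  each family is the attracting point of the other, and attracting points are in the boundary by
  \<open>limit_in_boundary\<close>; so the four points reduce to two, both in the boundary.\<close>

lemma convergence_subsequence:
  fixes \<gamma> :: "nat \<Rightarrow> 'g"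
  assumes \<gamma>: "inj \<gamma>" "range \<gamma> \<subseteq> carrier G"
  shows "\<exists>x\<in>topspace M. \<exists>y\<in>topspace M. \<exists>r. strict_mono r \<and>
    loc_unif_const mtopology (\<lambda>n. act (\<gamma> (r n))) (Inr y) (Inr x) \<and>
    loc_unif_const mtopology (\<lambda>n. act (inv (\<gamma> (r n)))) (Inr x) (Inr y)"
proof -
  have sub: "\<exists>x\<in>carrier G <+> topspace M. \<exists>y\<in>carrier G <+> topspace M. \<exists>r. strict_mono r \<and>
      loc_unif_const mtopology (\<lambda>n. act (\<gamma> (r n))) y x"
    if "inj \<gamma>" "range \<gamma> \<subseteq> carrier G" for \<gamma> :: "nat \<Rightarrow> 'g"
    using convergence that by (simp add: convergence_action_def)
  obtain x y r where x: "x \<in> carrier G <+> topspace M" and y: "y \<in> carrier G <+> topspace M"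
    and r: "strict_mono r" and c1: "loc_unif_const mtopology (\<lambda>n. act (\<gamma> (r n))) y x"
    using sub[OF \<gamma>] by blast
  have inj: "inj (\<lambda>n. inv (\<gamma> (r n)))"
  proof (rule injI)
    fix m n assume "inv (\<gamma> (r m)) = inv (\<gamma> (r n))"
    then have "\<gamma> (r m) = \<gamma> (r n)"
      using \<gamma>(2) by (metis inv_inv range_subsetD)
    then show "m = n" using injD[OF inj_subseq[OF \<gamma>(1) r]] by blast
  qed
  have ran: "range (\<lambda>n. inv (\<gamma> (r n))) \<subseteq> carrier G"
    using \<gamma>(2) by auto
  obtain x' y' s where x': "x' \<in> carrier G <+> topspace M" and y': "y' \<in> carrier G <+> topspace M"
    and s: "strict_mono s" and c2: "loc_unif_const mtopology (\<lambda>n. act (inv (\<gamma> (r (s n))))) y' x'"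
    using sub[OF inj ran] by blast
  have rs: "strict_mono (\<lambda>n. r (s n))"
    using r s by (simp add: strict_mono_def)
  have c1': "loc_unif_const mtopology (\<lambda>n. act (\<gamma> (r (s n)))) y x"
    using loc_unif_const_subseq[OF c1 s] .
  have in_G: "\<gamma> n \<in> carrier G" for n using \<gamma>(2) by auto
  have "y = x'"
  proof (rule repelling_eq_limit_of_inverses[OF c1' c2 x y x'])
    fix n z assume z: "z \<in> carrier G <+> topspace M"
    show "act (inv (\<gamma> (r (s n)))) z \<in> carrier G <+> topspace M \<and>
      act (\<gamma> (r (s n))) (act (inv (\<gamma> (r (s n)))) z) = z"
      using act_mult[of "\<gamma> (r (s n))" "inv (\<gamma> (r (s n)))" z] act_closed[OF _ z] act_one[OF z] in_G z
      by simp
  qed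
  have "y' = x"
  proof (rule repelling_eq_limit_of_inverses[OF c2 c1' x' y' x])
    fix n z assume z: "z \<in> carrier G <+> topspace M"
    show "act (\<gamma> (r (s n))) z \<in> carrier G <+> topspace M \<and>
      act (inv (\<gamma> (r (s n)))) (act (\<gamma> (r (s n))) z) = z"
      using act_mult[of "inv (\<gamma> (r (s n)))" "\<gamma> (r (s n))" z] act_closed[OF _ z] act_one[OF z] in_G z
      by simp
  qed
  have "inj (\<lambda>n. \<gamma> (r n))"
    using inj_subseq[OF \<gamma>(1) r] .
  then have "x \<in> Inr ` topspace M"
    using limit_in_boundary[OF _ _ x c1] in_G by blast
  moreover have "inj (\<lambda>n. inv (\<gamma> (r (s n))))"
    using inj_subseq[OF inj s] .
  then have "x' \<in> Inr ` topspace M"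
    using limit_in_boundary[OF _ _ x' c2] in_G by blast
  ultimately show ?thesis
    using c1' c2 rs \<open>y = x'\<close> \<open>y' = x\<close> by blast
qed

section \<open>Limits of boundary points and of group elements\<close>

lemma limitin_boundary_of_loc_unif_const:
  assumes "loc_unif_const mtopology (\<lambda>n. act (\<gamma> n)) (Inr y) (Inr x)"
    and "\<And>n. \<gamma> n \<in> carrier G" "x \<in> topspace M" "z \<in> topspace M" "z \<noteq> y"
  shows "limitin M (\<lambda>n. \<phi> (\<gamma> n) z) x sequentially"
proof -
  have "limitin mtopology (\<lambda>n. Inr (\<phi> (\<gamma> n) z)) (Inr x) sequentially"
    using loc_unif_const_limitin[OF assms(1), of "Inr z"] assms(3-5) by auto
  then show ?thesis
    using limitin_embedding_map[OF embedding_Inr, of "\<lambda>n. \<phi> (\<gamma> n) z" x] assms boundary_closed by auto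
qed

text \<open>\<gamma> n is the image of the neutral element, which is not the repelling point because
  that one lies in the boundary.\<close>

lemma limitin_group_of_loc_unif_const:
  assumes "loc_unif_const mtopology (\<lambda>n. act (\<gamma> n)) (Inr y) (Inr x)"
    and "\<And>n. \<gamma> n \<in> carrier G" "x \<in> topspace M"
  shows "limitin mtopology (\<lambda>n. Inl (\<gamma> n)) (Inr x) sequentially"
  using loc_unif_const_limitin[OF assms(1), of "Inl \<one>"] assms(2,3) by auto

text \<open>
  If \<open>a n\<close> came close to the inverse of \<open>\<gamma> n\<close> along a subsequence, then \<open>a n\<close> would approach
  the repelling point \<open>y\<close> of that subsequence and \<open>b n\<close>, being fixed and away from \<open>y\<close>, its
  attracting point \<open>x\<close>. But \<open>\<gamma> n\<close> maps the complement of a neighbourhood of \<open>y\<close> into a small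
  neighbourhood of \<open>x\<close>, hence its forward orbits cannot converge to \<open>a n\<close>.
\<close>

lemma loxodromic_attracting_far_from_inverse:
  assumes \<gamma>: "inj \<gamma>" and lox: "\<And>n. loxodromic_with G M \<phi> (\<gamma> n) (a n) (b n)"
    and far: "liminf (\<lambda>n. ereal (d (Inr (b n)) (Inr (a n)))) > 0"
  shows "\<exists>\<epsilon>>0. \<forall>\<^sub>F n in sequentially. d (Inr (a n)) (Inl (inv (\<gamma> n))) > \<epsilon>"
proof (rule ccontr)
  assume neg: "\<not> ?thesis"
  have in_G: "\<gamma> n \<in> carrier G" and in_M: "a n \<in> topspace M" "b n \<in> topspace M"
    and fixb: "\<phi> (\<gamma> n) (b n) = b n" for n
    using lox[of n] by (auto simp: loxodromic_with_def conv_limit_set_def)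
  obtain e0 where "0 < e0" "e0 < liminf (\<lambda>n. ereal (d (Inr (b n)) (Inr (a n))))"
    using far dense by blast
  then obtain e where e: "e > 0" "ereal e < liminf (\<lambda>n. ereal (d (Inr (b n)) (Inr (a n))))"
    by (cases e0) auto
  then have "\<forall>\<^sub>F n in sequentially. ereal e < ereal (d (Inr (b n)) (Inr (a n)))"
    using less_LiminfD by blast
  then have ev: "\<forall>\<^sub>F n in sequentially. e < d (Inr (b n)) (Inr (a n))" by simp
  have "\<exists>\<^sub>F n in sequentially. d (Inr (a n)) (Inl (inv (\<gamma> n))) \<le> inverse (Suc k) \<and>
      e < d (Inr (b n)) (Inr (a n))" for k
  proof -
    have "\<exists>\<^sub>F n in sequentially. d (Inr (a n)) (Inl (inv (\<gamma> n))) \<le> inverse (Suc k)"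
      using neg inverse_positive_iff_positive[of "real (Suc k)"]
      unfolding frequently_def not_le by auto
    then show ?thesis by (rule frequently_eventually_frequently) (rule ev)
  qed
  then obtain s where s: "strict_mono s"
    "\<And>k. d (Inr (a (s k))) (Inl (inv (\<gamma> (s k)))) \<le> inverse (Suc k) \<and>
      e < d (Inr (b (s k))) (Inr (a (s k)))"
    using strict_mono_choice[of "\<lambda>k n. d (Inr (a n)) (Inl (inv (\<gamma> n))) \<le> inverse (Suc k) \<and>
      e < d (Inr (b n)) (Inr (a n))"] by blast
  have "inj (\<lambda>n. \<gamma> (s n))"
    using inj_subseq[OF \<gamma> s(1)] .
  then obtain x y r where x: "x \<in> topspace M" and y: "y \<in> topspace M" and r: "strict_mono r"
    and c1: "loc_unif_const mtopology (\<lambda>n. act (\<gamma> (s (r n)))) (Inr y) (Inr x)"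
    and c2: "loc_unif_const mtopology (\<lambda>n. act (inv (\<gamma> (s (r n))))) (Inr x) (Inr y)"
    using convergence_subsequence[of "\<lambda>n. \<gamma> (s n)"] in_G by blast
  define t where "t n = s (r n)" for n
  have xT: "Inr x \<in> carrier G <+> topspace M" and yT: "Inr y \<in> carrier G <+> topspace M"
    using x y by auto
  have aT: "Inr (a n) \<in> carrier G <+> topspace M" and bT: "Inr (b n) \<in> carrier G <+> topspace M"
    and gT: "Inl (inv (\<gamma> n)) \<in> carrier G <+> topspace M" for n
    using in_M in_G by auto
  have far: "e < d (Inr (b (t n))) (Inr (a (t n)))" for n
    using s(2) by (simp add: t_def)
  have unif: "\<forall>\<^sub>F n in sequentially. act (\<gamma> (t n)) `
      (carrier G <+> topspace M - mball (Inr y) \<rho>) \<subseteq> mball (Inr x) \<eta>"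
    if "\<rho> > 0" "\<eta> > 0" for \<rho> \<eta>
    using loc_unif_const_uniform[OF c1 compact, of "mball (Inr y) \<rho>" "mball (Inr x) \<eta>"] that xT yT
    by (simp add: t_def)
  have a_near: "\<forall>\<^sub>F n in sequentially. Inr (a (t n)) \<in> mball (Inr y) \<rho>" if "\<rho> > 0" for \<rho>
  proof -
    have "limitin mtopology (\<lambda>n. Inl (inv (\<gamma> (t n)))) (Inr y) sequentially"
      using limitin_group_of_loc_unif_const[OF c2] in_G y by (simp add: t_def)
    then have "\<forall>\<^sub>F n in sequentially. Inl (inv (\<gamma> (t n))) \<in> mball (Inr y) (\<rho>/2)"
      by (rule eventually_in_mball) (use that in simp)
    moreover have "\<forall>\<^sub>F n in sequentially. inverse (real (Suc n)) < \<rho>/2"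
      using that LIMSEQ_inverse_real_of_nat order_tendstoD(2)[of _ 0 sequentially "\<rho>/2"] by auto
    ultimately show ?thesis
    proof eventually_elim
      case (elim n)
      have "d (Inr (a (t n))) (Inl (inv (\<gamma> (t n)))) \<le> inverse (Suc (r n))"
        using s(2) by (simp add: t_def)
      also have "\<dots> \<le> inverse (Suc n)"
        using seq_suble[OF r, of n] by (simp add: field_simps)
      finally show ?case
        using elim triangle[of "Inr y" "Inl (inv (\<gamma> (t n)))" "Inr (a (t n))"] aT gT yT
          commute[of "Inr (a (t n))" "Inl (inv (\<gamma> (t n)))"] by simp
    qed
  qed
  have b_near: "\<forall>\<^sub>F n in sequentially. Inr (b (t n)) \<in> mball (Inr x) \<eta>" if "\<eta> > 0" for \<eta>
  proof -
    have "e / 2 > 0" using e(1) by simp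
    show ?thesis
      using unif[OF \<open>e / 2 > 0\<close> that] a_near[OF \<open>e / 2 > 0\<close>]
    proof eventually_elim
      case (elim n)
      have "Inr (b (t n)) \<notin> mball (Inr y) (e/2)"
        using elim(2) far[of n] triangle[of "Inr (b (t n))" "Inr y" "Inr (a (t n))"] aT bT yT
          commute[of "Inr (b (t n))" "Inr y"] by simp
      then have "act (\<gamma> (t n)) (Inr (b (t n))) \<in> mball (Inr x) \<eta>"
        using elim(1) bT by blast
      then show ?case using fixb by simp
    qed
  qed
  have "x \<noteq> y"
  proof
    assume "x = y"
    have "\<forall>\<^sub>F n in sequentially. False"
      using a_near[OF half_gt_zero[OF e(1)]] b_near[OF half_gt_zero[OF e(1)]]
    proof eventually_elim
      case (elim n)
      then show ?case
        using \<open>x = y\<close> far[of n] triangle[of "Inr (b (t n))" "Inr y" "Inr (a (t n))"]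
          commute[of "Inr (b (t n))" "Inr y"] aT bT yT by simp
    qed
    then show False by simp
  qed
  obtain z where z: "z \<in> topspace M" "z \<noteq> x" "z \<noteq> y" using three_points by blast
  then have zT: "Inr z \<in> carrier G <+> topspace M" by auto
  \<comment> \<open>Half the distance of \<open>x\<close> and \<open>y\<close> makes the two balls
    disjoint. The other terms keep \<open>z\<close> out of both, so that its orbit starts outside
    the ball about \<open>y\<close> and \<open>z\<close> is not the repelling point
    \<open>b (t n)\<close>.\<close>
  define \<rho> where "\<rho> = min (d (Inr x) (Inr y) / 2) (min (d (Inr x) (Inr z)) (d (Inr y) (Inr z)))"
  have "\<rho> > 0" using z \<open>x \<noteq> y\<close> xT yT zT by (simp add: \<rho>_def)
  have disj: "w \<notin> mball (Inr y) \<rho>" if "w \<in> mball (Inr x) \<rho>" for w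
    using that triangle[of "Inr x" w "Inr y"] commute[of w "Inr y"] xT yT by (simp add: \<rho>_def)
  obtain n where n: "act (\<gamma> (t n)) ` (carrier G <+> topspace M - mball (Inr y) \<rho>) \<subseteq> mball (Inr x) \<rho>"
    "Inr (a (t n)) \<in> mball (Inr y) \<rho>" "Inr (b (t n)) \<in> mball (Inr x) \<rho>"
    using eventually_happens[OF eventually_conj[OF unif[OF \<open>\<rho> > 0\<close> \<open>\<rho> > 0\<close>]
      eventually_conj[OF a_near[OF \<open>\<rho> > 0\<close>] b_near[OF \<open>\<rho> > 0\<close>]]]] by auto
  define g where "g = \<gamma> (t n)"
  have g: "g \<in> carrier G" using in_G by (simp add: g_def)
  have orbit: "Inr (\<phi> (g [^] k) z) \<notin> mball (Inr y) \<rho>" for k :: nat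
  proof (induction k)
    case 0
    then show ?case using act_one[OF zT] by (simp add: \<rho>_def)
  next
    case (Suc k)
    have "Inr (\<phi> (g [^] k) z) \<in> carrier G <+> topspace M - mball (Inr y) \<rho>"
      using Suc boundary_closed[of "g [^] k" z] z g by auto
    then have "act g (Inr (\<phi> (g [^] k) z)) \<in> mball (Inr x) \<rho>"
      using n(1) unfolding g_def by blast
    moreover have "\<phi> (g [^] Suc k) z = \<phi> g (\<phi> (g [^] k) z)"
      using boundary_mult[of g "g [^] k" z] z g by (simp only: nat_pow_Suc2 nat_pow_closed)
    ultimately show ?case using disj by simp
  qed
  have "z \<noteq> b (t n)" using n(3) by (auto simp: \<rho>_def)
  then have "limitin M (\<lambda>k. \<phi> (g [^] k) z) (a (t n)) sequentially"
    using loc_unif_const_limitin lox[of "t n"] z in_M unfolding loxodromic_with_def g_def by metis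
  then have "limitin mtopology (\<lambda>k. Inr (\<phi> (g [^] k) z)) (Inr (a (t n))) sequentially"
    using limitin_embedding_map[OF embedding_Inr, of "\<lambda>k. \<phi> (g [^] k) z" "a (t n)" sequentially]
      in_M(1)[of "t n"] boundary_closed[OF nat_pow_closed[OF g] z(1)] by blast
  then have "\<forall>\<^sub>F k in sequentially. Inr (\<phi> (g [^] k) z) \<in> mball (Inr y) \<rho>"
    using n(2) unfolding limitin_def by (meson openin_mball)
  then have "\<exists>k::nat. Inr (\<phi> (g [^] k) z) \<in> mball (Inr y) \<rho>"
    by (rule eventually_happens'[OF sequentially_bot])
  then show False using orbit by blast
qed

end

section \<open>The limiting cocycles\<close>

context hyperbolic_space
begin

text \<open>By \<open>eventually_tending_to\<close> these sets form a base of the filter of points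
  tending to \<open>x\<close>.\<close>

abbreviation near :: "real \<Rightarrow> (nat \<Rightarrow> 'a) set \<Rightarrow> 'a \<Rightarrow> bool" where
  "near r x p \<equiv> ereal r \<le> extended_gromov_product b (Inr x) (Inl p)"

lemma le_dist_of_extended_gromov_product:
  assumes "ereal c \<le> extended_gromov_product (a::'a) (Inr x) (Inl p)" "x \<in> gromov_boundary"
  shows "c \<le> dist a p"
proof (rule dense_le)
  fix c' assume "c' < c"
  obtain u where "u \<in> x" using boundary_nonempty[OF assms(2)] by blast
  then have "\<forall>\<^sub>F n in sequentially. c' < gromov_product a (u n) p"
    using assms(1) \<open>c' < c\<close> by (simp add: le_extended_gromov_product_iff)
  then have "\<exists>n. c' < gromov_product a (u n) p"
    by (rule eventually_happens'[OF sequentially_bot])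
  then show "c' \<le> dist a p"
    using gromov_product_le_dist(2) by (meson less_imp_le order_trans)
qed

lemma gromov_product_near_boundary:
  assumes "ereal r \<le> extended_gromov_product (a::'a) (Inr x) (Inl p)"
    and "ereal r \<le> extended_gromov_product a (Inr x) (Inl q)" and "x \<in> gromov_boundary"
  shows "r - \<delta> \<le> gromov_product a p q"
  using ultra_boundary[OF assms] by (simp add: extended_gromov_product_Inl)

lemma extended_gromov_product_mono:
  "ereal c \<le> extended_gromov_product a x y \<Longrightarrow> c' \<le> c \<Longrightarrow> ereal c' \<le> extended_gromov_product a x y"
  by (rule order_trans[of _ "ereal c"]) auto

end

context potential_space
begin

text \<open>For \<psi> the distance this is a Busemann function normalised at \<open>b\<close>. It
  is taken at an arbitrary point \<open>e\<close>, which keeps the estimates free of the group;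
  \<sigma> is its value at the image of \<open>b\<close> under the inverse.\<close>

definition busemann :: "'a \<Rightarrow> (nat \<Rightarrow> 'a) set \<Rightarrow> ereal" where
  "busemann e x = Limsup (tending_to x) (\<lambda>p. ereal (\<psi> e p - \<psi> b p))"

text \<open>The order of quantifiers matters: \<open>k\<close> is the constant of
  \<open>double_difference_bounded\<close>, while \<open>r\<close> may depend on \<open>e\<close>
  and \<open>x\<close>.\<close>

lemma busemann_approx:
  obtains k where "0 \<le> k"
    and "\<And>e x. x \<in> gromov_boundary \<Longrightarrow> \<bar>busemann e x\<bar> \<noteq> \<infinity>"
    and "\<And>e x. x \<in> gromov_boundary \<Longrightarrow>
      \<exists>r. \<forall>p. near r x p \<longrightarrow> \<bar>(\<psi> e p - \<psi> b p) - real_of_ereal (busemann e x)\<bar> \<le> k"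
proof -
  obtain k where "k \<ge> 0" and k: "\<And>e p p'. gromov_product b p e + 2 * \<delta> + 1 \<le> gromov_product b p p' \<Longrightarrow>
     \<bar>(\<psi> e p - \<psi> b p) - (\<psi> e p' - \<psi> b p')\<bar> \<le> k"
    using double_difference_bounded by blast
  \<comment> \<open>By hyperbolicity two points with this product have a mutual product of at least
    \<open>dist b e + 2 * \<delta> + 1\<close>, and the product of either with \<open>e\<close> is
    at most \<open>dist b e\<close>.\<close>
  have main: "\<bar>busemann e x\<bar> \<noteq> \<infinity> \<and> \<bar>(\<psi> e p - \<psi> b p) - real_of_ereal (busemann e x)\<bar> \<le> k"
    if x: "x \<in> gromov_boundary"
      and p: "ereal (dist b e + 3 * \<delta> + 1) \<le> extended_gromov_product b (Inr x) (Inl p)" for e x p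
  proof -
    have "\<bar>(\<psi> e q - \<psi> b q) - (\<psi> e p - \<psi> b p)\<bar> \<le> k"
      if "ereal (dist b e + 3 * \<delta> + 1) \<le> extended_gromov_product b (Inr x) (Inl q)" for q
      using gromov_product_near_boundary[OF that p x] gromov_product_le_dist(2)[of b q e]
      by (intro k) simp
    then have "\<forall>\<^sub>F q in tending_to x. \<bar>(\<psi> e q - \<psi> b q) - (\<psi> e p - \<psi> b p)\<bar> \<le> k"
      unfolding eventually_tending_to[OF x] by blast
    from Limsup_near_constant[OF tending_to_neq_bot[OF x] this]
    show ?thesis by (simp add: busemann_def abs_minus_commute)
  qed
  show ?thesis
  proof (rule that[OF \<open>0 \<le> k\<close>])
    show "\<bar>busemann e x\<bar> \<noteq> \<infinity>" if x: "x \<in> gromov_boundary" for e x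
    proof -
      obtain p where "near (dist b e + 3 * \<delta> + 1) x p"
        using approach_boundary[OF x] by blast
      from main[OF x this] show ?thesis by (rule conjunct1)
    qed
    show "\<exists>r. \<forall>p. near r x p \<longrightarrow> \<bar>(\<psi> e p - \<psi> b p) - real_of_ereal (busemann e x)\<bar> \<le> k"
      if "x \<in> gromov_boundary" for e x
      using main[OF that] by blast
  qed
qed

text \<open>The points \<open>p\<close> and \<open>q\<close> are exchanged one at a time: for fixed
  \<open>p\<close> the change in \<open>q\<close> is a double difference, and for the change in
  \<open>p\<close> the reversed potential is used. Both need a bound on the product of
  \<open>p\<close> and \<open>q\<close>, which holds near two distinct boundary points.\<close>

lemma G_potential_approx:
  obtains k where "0 \<le> k"
    and "\<And>x y. x \<in> gromov_boundary \<Longrightarrow> y \<in> gromov_boundary \<Longrightarrow> x \<noteq> y \<Longrightarrow> \<bar>G_potential \<psi> b (x, y)\<bar> \<noteq> \<infinity>"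
    and "\<And>x y. x \<in> gromov_boundary \<Longrightarrow> y \<in> gromov_boundary \<Longrightarrow> x \<noteq> y \<Longrightarrow>
      \<exists>r. \<forall>p q. near r x p \<longrightarrow> near r y q \<longrightarrow>
        \<bar>(\<psi> p b + \<psi> b q - \<psi> p q) - real_of_ereal (G_potential \<psi> b (x, y))\<bar> \<le> k"
proof -
  interpret reverse: potential_space b \<delta> "\<lambda>p q. \<psi> q p"
    using geodesic coarsely_additive_potential_reverse[OF potential] by unfold_locales
  obtain k1 where "k1 \<ge> 0" and k1: "\<And>e p p'. gromov_product b p e + 2 * \<delta> + 1 \<le> gromov_product b p p' \<Longrightarrow>
     \<bar>(\<psi> e p - \<psi> b p) - (\<psi> e p' - \<psi> b p')\<bar> \<le> k1"
    using double_difference_bounded by blast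
  obtain k2 where "k2 \<ge> 0" and k2: "\<And>e p p'. gromov_product b p e + 2 * \<delta> + 1 \<le> gromov_product b p p' \<Longrightarrow>
     \<bar>(\<psi> p e - \<psi> p b) - (\<psi> p' e - \<psi> p' b)\<bar> \<le> k2"
    using reverse.double_difference_bounded by blast
  have approx: "\<bar>G_potential \<psi> b (x, y)\<bar> \<noteq> \<infinity> \<and>
     (\<exists>r. \<forall>p q. near r x p \<longrightarrow> near r y q \<longrightarrow>
        \<bar>(\<psi> p b + \<psi> b q - \<psi> p q) - real_of_ereal (G_potential \<psi> b (x, y))\<bar> \<le> k1 + k2)"
    if x: "x \<in> gromov_boundary" and y: "y \<in> gromov_boundary" and "x \<noteq> y" for x y
  proof -
    define h where "h p q = \<psi> p b + \<psi> b q - \<psi> p q" for p q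
    obtain c where c: "\<not> ereal c \<le> extended_gromov_product b (Inr x) (Inr y)"
      using extended_gromov_product_bounded[OF x y \<open>x \<noteq> y\<close>] by blast
    \<comment> \<open>Two applications of the hyperbolic inequality bound the product of
      \<open>p\<close> and \<open>q\<close> by \<open>c + 2 * \<delta>\<close>. On top of this come
      2\<delta> + 1 for the double difference and \<delta> for comparing two points near the same
      boundary point.\<close>
    define r where "r = c + 5 * \<delta> + 1"
    let ?X = "near r x" and ?Y = "near r y"
    have apart: "gromov_product b p q < c + 2 * \<delta>" if p: "?X p" and q: "?Y q" for p q
    proof (rule ccontr)
      assume "\<not> ?thesis"
      then have pq: "ereal (c + 2 * \<delta>) \<le> extended_gromov_product b (Inl p) (Inl q)"
        by (simp add: extended_gromov_product_Inl)
      have "ereal (c + 2 * \<delta> - \<delta>) \<le> extended_gromov_product b (Inr x) (Inl q)"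
        by (rule ultra[OF extended_gromov_product_mono[OF p] pq]) (use \<delta>_nonneg in \<open>auto simp: r_def\<close>)
      then have 1: "ereal (c + \<delta>) \<le> extended_gromov_product b (Inr x) (Inl q)" by (simp add: algebra_simps)
      have 2: "ereal (c + \<delta>) \<le> extended_gromov_product b (Inl q) (Inr y)"
        using extended_gromov_product_mono[OF q, of "c + \<delta>"] \<delta>_nonneg
        by (simp add: r_def extended_gromov_product_commute[of b "Inl q"])
      show False using ultra[OF 1 2] c by auto
    qed
    have close: "\<bar>h p q - h p' q'\<bar> \<le> k1 + k2" if "?X p" "?X p'" "?Y q" "?Y q'" for p p' q q'
    proof -
      have "\<bar>(\<psi> p q - \<psi> b q) - (\<psi> p q' - \<psi> b q')\<bar> \<le> k1"
        using gromov_product_near_boundary[OF that(3,4) y] apart[OF that(1,3)]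
        by (intro k1) (simp add: r_def gromov_product_commute[of b q p])
      moreover have "\<bar>(\<psi> p q' - \<psi> p b) - (\<psi> p' q' - \<psi> p' b)\<bar> \<le> k2"
        using gromov_product_near_boundary[OF that(1,2) x] apart[OF that(1,4)]
        by (intro k2) (simp add: r_def)
      ultimately show ?thesis unfolding h_def by linarith
    qed
    have main: "\<bar>G_potential \<psi> b (x, y)\<bar> \<noteq> \<infinity> \<and>
        \<bar>real_of_ereal (G_potential \<psi> b (x, y)) - h p q\<bar> \<le> k1 + k2" if p: "?X p" and q: "?Y q" for p q
    proof -
      have "\<forall>\<^sub>F p' in tending_to x. ?X p'" "\<forall>\<^sub>F q' in tending_to y. ?Y q'"
        by (auto simp: eventually_tending_to x y)
      then have "\<forall>\<^sub>F z in tending_to x \<times>\<^sub>F tending_to y. ?X (fst z) \<and> ?Y (snd z)"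
        by (rule eventually_prodI)
      then have "\<forall>\<^sub>F z in tending_to x \<times>\<^sub>F tending_to y. \<bar>h (fst z) (snd z) - h p q\<bar> \<le> k1 + k2"
        by eventually_elim (use close p q in blast)
      moreover have "tending_to x \<times>\<^sub>F tending_to y \<noteq> bot"
        using tending_to_neq_bot x y by (simp add: prod_filter_eq_bot)
      ultimately show ?thesis
        using Limsup_near_constant[of _ "\<lambda>z. h (fst z) (snd z)"]
        by (simp add: G_potential_def h_def case_prod_unfold)
    qed
    obtain p q where "?X p" "?Y q" using approach_boundary x y by metis
    from main[OF this] have "\<bar>G_potential \<psi> b (x, y)\<bar> \<noteq> \<infinity>" by (rule conjunct1)
    moreover have "\<forall>p q. ?X p \<longrightarrow> ?Y q \<longrightarrow>
        \<bar>(\<psi> p b + \<psi> b q - \<psi> p q) - real_of_ereal (G_potential \<psi> b (x, y))\<bar> \<le> k1 + k2"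
      using main unfolding h_def by (simp add: abs_minus_commute)
    ultimately show ?thesis by blast
  qed
  show ?thesis
    by (rule that[of "k1 + k2"]) (use approx \<open>k1 \<ge> 0\<close> \<open>k2 \<ge> 0\<close> in \<open>simp_all\<close>)
qed

lemma G_potential_bounded_below:
  "\<exists>m. \<forall>z\<in>distinct_pairs gromov_boundary_topology. ereal m \<le> G_potential \<psi> b z"
proof -
  obtain m where m: "\<And>p q. m \<le> \<psi> p b + \<psi> b q - \<psi> p q"
    using triangle_defect_bounded_below by blast
  have "ereal m \<le> G_potential \<psi> b z" if z_in: "z \<in> distinct_pairs gromov_boundary_topology" for z
  proof -
    obtain x y where z: "z = (x, y)" "x \<in> gromov_boundary" "y \<in> gromov_boundary"
      using z_in by (cases z) (auto simp: distinct_pairs_def topspace_gromov_boundary_topology)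
    then have "tending_to x \<times>\<^sub>F tending_to y \<noteq> bot"
      using tending_to_neq_bot by (simp add: prod_filter_eq_bot)
    moreover have "ereal m \<le> Liminf (tending_to x \<times>\<^sub>F tending_to y) (\<lambda>(p, q). ereal (\<psi> p b + \<psi> b q - \<psi> p q))"
      by (rule Liminf_bounded) (simp add: m case_prod_unfold)
    ultimately show ?thesis
      unfolding z G_potential_def using Liminf_le_Limsup order_trans by fastforce
  qed
  then show ?thesis by blast
qed

text \<open>Points \<open>p\<close> and \<open>q\<close> that are close enough to a pair near (x, y)
  are also close to (x, y), so both values of G are within \<open>k\<close> of the same expression.
  It is essential that \<open>k\<close> does not depend on the pair.\<close>

lemma G_potential_locally_bounded:
  "locally_bounded (subtopology (prod_topology gromov_boundary_topology gromov_boundary_topology)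
     (distinct_pairs gromov_boundary_topology)) (\<lambda>z. real_of_ereal (G_potential \<psi> b z))"
  unfolding locally_bounded_def
proof
  let ?M = "gromov_boundary_topology :: (nat \<Rightarrow> 'a) set topology"
  fix z assume "z \<in> topspace (subtopology (prod_topology ?M ?M) (distinct_pairs ?M))"
  then obtain x y where z: "z = (x, y)" and x: "x \<in> gromov_boundary" and y: "y \<in> gromov_boundary" and "x \<noteq> y"
    by (auto simp: distinct_pairs_def topspace_gromov_boundary_topology)
  obtain k where "0 \<le> k"
    and "\<And>x y. x \<in> gromov_boundary \<Longrightarrow> y \<in> gromov_boundary \<Longrightarrow> x \<noteq> y \<Longrightarrow> \<bar>G_potential \<psi> b (x, y)\<bar> \<noteq> \<infinity>"
    and k: "\<And>x y. x \<in> gromov_boundary \<Longrightarrow> y \<in> gromov_boundary \<Longrightarrow> x \<noteq> y \<Longrightarrow>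
      \<exists>r. \<forall>p q. near r x p \<longrightarrow> near r y q \<longrightarrow>
        \<bar>(\<psi> p b + \<psi> b q - \<psi> p q) - real_of_ereal (G_potential \<psi> b (x, y))\<bar> \<le> k"
    by (rule G_potential_approx) (rule that)
  obtain r where r: "\<And>p q. near r x p \<Longrightarrow>
        near r y q \<Longrightarrow>
        \<bar>(\<psi> p b + \<psi> b q - \<psi> p q) - real_of_ereal (G_potential \<psi> b (x, y))\<bar> \<le> k"
    using k[OF x y \<open>x \<noteq> y\<close>] by blast
  obtain V where V: "openin ?M V" "x \<in> V"
    "\<forall>x'\<in>V. ereal (r + \<delta>) \<le> extended_gromov_product b (Inr x) (Inr x')"
    using boundary_open_neighbourhood[OF x] by blast
  obtain W where W: "openin ?M W" "y \<in> W"
    "\<forall>y'\<in>W. ereal (r + \<delta>) \<le> extended_gromov_product b (Inr y) (Inr y')"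
    using boundary_open_neighbourhood[OF y] by blast
  have "\<bar>real_of_ereal (G_potential \<psi> b (x', y'))\<bar> \<le> \<bar>real_of_ereal (G_potential \<psi> b (x, y))\<bar> + 2 * k"
    if "x' \<in> V" "y' \<in> W" "x' \<noteq> y'" for x' y'
  proof -
    have x': "x' \<in> gromov_boundary" and y': "y' \<in> gromov_boundary"
      using that V(1) W(1) openin_subset topspace_gromov_boundary_topology by blast+
    obtain s where s: "\<And>p q. near s x' p \<Longrightarrow>
        near s y' q \<Longrightarrow>
        \<bar>(\<psi> p b + \<psi> b q - \<psi> p q) - real_of_ereal (G_potential \<psi> b (x', y'))\<bar> \<le> k"
      using k[OF x' y' \<open>x' \<noteq> y'\<close>] by blast
    obtain p q where p: "near (max s (r + \<delta>)) x' p"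
      and q: "near (max s (r + \<delta>)) y' q"
      using approach_boundary x' y' by metis
    have "near (r + \<delta> - \<delta>) x p"
      by (rule ultra[OF V(3)[rule_format, OF that(1)] extended_gromov_product_mono[OF p]]) (use x' in auto)
    moreover have "near (r + \<delta> - \<delta>) y q"
      by (rule ultra[OF W(3)[rule_format, OF that(2)] extended_gromov_product_mono[OF q]]) (use y' in auto)
    ultimately have "near r x p" "near r y q" by simp_all
    from r[OF this] s[OF extended_gromov_product_mono[OF p max.cobounded1]
        extended_gromov_product_mono[OF q max.cobounded1]]
    show ?thesis by linarith
  qed
  note bound = this
  have "bounded ((\<lambda>z. real_of_ereal (G_potential \<psi> b z)) ` (V \<times> W \<inter> distinct_pairs ?M))"
  proof (rule boundedI)
    fix v assume "v \<in> (\<lambda>z. real_of_ereal (G_potential \<psi> b z)) ` (V \<times> W \<inter> distinct_pairs ?M)"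
    then obtain x' y' where "x' \<in> V" "y' \<in> W" "x' \<noteq> y'" "v = real_of_ereal (G_potential \<psi> b (x', y'))"
      unfolding distinct_pairs_def by blast
    then show "norm v \<le> \<bar>real_of_ereal (G_potential \<psi> b (x, y))\<bar> + 2 * k"
      using bound[of x' y'] by simp
  qed
  moreover have "openin (subtopology (prod_topology ?M ?M) (distinct_pairs ?M)) (V \<times> W \<inter> distinct_pairs ?M)"
    using V(1) W(1) by (intro openin_subtopology_Int) (simp add: openin_prod_Times_iff)
  moreover have "z \<in> V \<times> W \<inter> distinct_pairs ?M"
    using V(2) W(2) x y \<open>x \<noteq> y\<close> z by (auto simp: distinct_pairs_def topspace_gromov_boundary_topology)
  ultimately show "\<exists>U. openin (subtopology (prod_topology ?M ?M) (distinct_pairs ?M)) U \<and> z \<in> U \<and>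
      bounded ((\<lambda>z. real_of_ereal (G_potential \<psi> b z)) ` U)"
    by blast
qed

end

section \<open>Group actions and potentials\<close>

lemma coarse_cocycle_mono:
  assumes "coarse_cocycle G M \<phi> \<kappa> \<sigma>" "\<kappa> \<le> \<kappa>'"
  shows "coarse_cocycle G M \<phi> \<kappa>' \<sigma>"
  using assms unfolding coarse_cocycle_def by (meson ereal_less_eq(3) order_trans)

locale potential_group =
  potential_space b \<delta> \<psi> +
  compactified_group "isom_group\<lparr>carrier := \<Gamma>\<rparr>" gromov_boundary_topology boundary_action d
  for b :: "'a::metric_space" and \<delta> \<psi> and \<Gamma> :: "('a \<Rightarrow> 'a) set" and d +
  assumes subgroup: "subgroup \<Gamma> isom_group"
    and invariant: "invariant_potential \<Gamma> \<psi>"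
begin

section \<open>Group elements as isometries, and the cocycle identity\<close>

abbreviation \<sigma> :: "('a \<Rightarrow> 'a) \<Rightarrow> (nat \<Rightarrow> 'a) set \<Rightarrow> real" where
  "\<sigma> \<gamma> x \<equiv> real_of_ereal (sigma_potential \<psi> b \<gamma> x)"

lemma isometry: "\<gamma> \<in> \<Gamma> \<Longrightarrow> dist (\<gamma> x) (\<gamma> y) = dist x y"
  and bij: "\<gamma> \<in> \<Gamma> \<Longrightarrow> bij \<gamma>"
  using subgroup.subset[OF subgroup] by (auto simp: isom_group_def Bij_UNIV)

lemma mult_eq_comp: "g \<in> \<Gamma> \<Longrightarrow> h \<in> \<Gamma> \<Longrightarrow> g \<otimes>\<^bsub>isom_group\<lparr>carrier := \<Gamma>\<rparr>\<^esub> h = g \<circ> h"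
  using bij by (auto simp: isom_group_def BijGroup_def Bij_UNIV compose_def fun_eq_iff)

lemma inv_consistent: "\<gamma> \<in> \<Gamma> \<Longrightarrow> inv\<^bsub>isom_group\<lparr>carrier := \<Gamma>\<rparr>\<^esub> \<gamma> = inv\<^bsub>isom_group\<^esub> \<gamma>"
  by (rule group.m_inv_consistent[OF group_isom_group subgroup])

lemma inv_in_group: "\<gamma> \<in> \<Gamma> \<Longrightarrow> inv\<^bsub>isom_group\<^esub> \<gamma> \<in> \<Gamma>"
  using subgroup.m_inv_closed[OF subgroup] .

lemma inv_apply: "\<gamma> \<in> \<Gamma> \<Longrightarrow> \<gamma> ((inv\<^bsub>isom_group\<^esub> \<gamma>) x) = x"
  "\<gamma> \<in> \<Gamma> \<Longrightarrow> (inv\<^bsub>isom_group\<^esub> \<gamma>) (\<gamma> x) = x"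
  using inv_isom_group[of \<gamma>] subgroup.subset[OF subgroup] bij[of \<gamma>]
  by (auto simp: bij_def surj_f_inv_f inv_f_f subset_iff)

lemma invariance: "\<gamma> \<in> \<Gamma> \<Longrightarrow> \<psi> (\<gamma> p) (\<gamma> q) = \<psi> p q"
  using invariant by (simp add: invariant_potential_def)

lemma action_closed: "\<gamma> \<in> \<Gamma> \<Longrightarrow> x \<in> gromov_boundary \<Longrightarrow> boundary_action \<gamma> x \<in> gromov_boundary"
  using boundary_closed[of \<gamma> x] by (simp add: topspace_gromov_boundary_topology)

lemma sigma_eq_busemann: "sigma_potential \<psi> b \<gamma> x = busemann ((inv\<^bsub>isom_group\<^esub> \<gamma>) b) x"
  by (simp add: sigma_potential_def busemann_def)

lemma near_action:
  assumes "near (r + dist b (\<gamma> b)) x p" "\<gamma> \<in> \<Gamma>"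
  shows "near r (boundary_action \<gamma> x) (\<gamma> p)"
proof -
  have "ereal (r + dist b (\<gamma> b)) \<le> extended_gromov_product (\<gamma> b) (Inr (boundary_action \<gamma> x)) (Inl (\<gamma> p))"
    using assms(1) extended_gromov_product_isometry[of \<gamma> b "Inr x" "Inl p"] isometry[OF assms(2)] by simp
  from extended_gromov_product_base[OF this, of b] show ?thesis
    by (simp add: dist_commute)
qed

lemma sigma_approx:
  obtains k where "0 \<le> k"
    and "\<And>\<gamma> x. x \<in> gromov_boundary \<Longrightarrow> \<bar>sigma_potential \<psi> b \<gamma> x\<bar> \<noteq> \<infinity>"
    and "\<And>\<gamma> x. x \<in> gromov_boundary \<Longrightarrow>
      \<exists>r. \<forall>p. near r x p \<longrightarrow> \<bar>(\<psi> ((inv\<^bsub>isom_group\<^esub> \<gamma>) b) p - \<psi> b p) - \<sigma> \<gamma> x\<bar> \<le> k"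
  using busemann_approx unfolding sigma_eq_busemann by metis

text \<open>At points of X the identity is exact: f(gh, p) = f(g, h p) + f(h, p). Replacing three
  limits by such values costs 3k; coarse continuity replaces only two.\<close>

lemma coarse_cocycle_sigma:
  "\<exists>\<kappa>\<ge>0. coarse_cocycle (isom_group\<lparr>carrier := \<Gamma>\<rparr>) gromov_boundary_topology boundary_action \<kappa> \<sigma>"
proof -
  obtain k where "0 \<le> k"
    and "\<And>\<gamma> x. x \<in> gromov_boundary \<Longrightarrow> \<bar>sigma_potential \<psi> b \<gamma> x\<bar> \<noteq> \<infinity>"
    and k: "\<And>\<gamma> x. x \<in> gromov_boundary \<Longrightarrow>
      \<exists>r. \<forall>p. near r x p \<longrightarrow> \<bar>(\<psi> ((inv\<^bsub>isom_group\<^esub> \<gamma>) b) p - \<psi> b p) - \<sigma> \<gamma> x\<bar> \<le> k"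
    by (rule sigma_approx) (rule that)
  define f where "f \<gamma> p = \<psi> ((inv\<^bsub>isom_group\<^esub> \<gamma>) b) p - \<psi> b p" for \<gamma> p
  have k: "\<exists>r. \<forall>p. near r x p \<longrightarrow> \<bar>f \<gamma> p - \<sigma> \<gamma> x\<bar> \<le> k" if "x \<in> gromov_boundary" for \<gamma> x
    using k[OF that] by (simp add: f_def)
  have "coarse_cocycle (isom_group\<lparr>carrier := \<Gamma>\<rparr>) gromov_boundary_topology boundary_action (3 * k) \<sigma>"
    unfolding coarse_cocycle_def topspace_gromov_boundary_topology
  proof (intro conjI ballI)
    fix \<gamma> :: "'a \<Rightarrow> 'a" and x0 :: "(nat \<Rightarrow> 'a) set" assume x0: "x0 \<in> gromov_boundary"
    obtain r where r: "\<forall>p. near r x0 p \<longrightarrow> \<bar>f \<gamma> p - \<sigma> \<gamma> x0\<bar> \<le> k"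
      using k[OF x0] by blast
    obtain V where V: "openin gromov_boundary_topology V" "x0 \<in> V"
      "\<forall>x\<in>V. ereal (r + \<delta>) \<le> extended_gromov_product b (Inr x0) (Inr x)"
      using boundary_open_neighbourhood[OF x0] by blast
    have "\<bar>\<sigma> \<gamma> x0 - \<sigma> \<gamma> x\<bar> \<le> 3 * k" if "x \<in> V" for x
    proof -
      have x: "x \<in> gromov_boundary"
        using that V(1) openin_subset topspace_gromov_boundary_topology by blast
      obtain s where s: "\<forall>p. near s x p \<longrightarrow> \<bar>f \<gamma> p - \<sigma> \<gamma> x\<bar> \<le> k"
        using k[OF x] by blast
      obtain p where p: "near (max s (r + \<delta>)) x p" using approach_boundary[OF x] by blast
      have "near (r + \<delta> - \<delta>) x0 p"
        by (rule ultra[OF V(3)[rule_format, OF that] extended_gromov_product_mono[OF p]]) (use x in auto)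
      then have "\<bar>f \<gamma> p - \<sigma> \<gamma> x0\<bar> \<le> k" using r by simp
      moreover have "\<bar>f \<gamma> p - \<sigma> \<gamma> x\<bar> \<le> k"
        using s extended_gromov_product_mono[OF p max.cobounded1] by blast
      ultimately show ?thesis using \<open>0 \<le> k\<close> by linarith
    qed
    then have "\<forall>\<^sub>F x in atin gromov_boundary_topology x0. ereal \<bar>\<sigma> \<gamma> x0 - \<sigma> \<gamma> x\<bar> \<le> ereal (3 * k)"
      using V(1,2) unfolding eventually_atin by auto
    then show "Limsup (atin gromov_boundary_topology x0) (\<lambda>x. ereal \<bar>\<sigma> \<gamma> x0 - \<sigma> \<gamma> x\<bar>) \<le> ereal (3 * k)"
      by (rule Limsup_bounded)
  next
    fix g h :: "'a \<Rightarrow> 'a" and x :: "(nat \<Rightarrow> 'a) set"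
    assume "g \<in> carrier (isom_group\<lparr>carrier := \<Gamma>\<rparr>)" "h \<in> carrier (isom_group\<lparr>carrier := \<Gamma>\<rparr>)"
      and x: "x \<in> gromov_boundary"
    then have g: "g \<in> \<Gamma>" and h: "h \<in> \<Gamma>" by auto
    let ?gh = "g \<otimes>\<^bsub>isom_group\<lparr>carrier := \<Gamma>\<rparr>\<^esub> h"
    have gh: "?gh \<in> \<Gamma>" using m_closed[of g h] g h by simp
    obtain r1 where r1: "\<forall>p. near r1 x p \<longrightarrow> \<bar>f ?gh p - \<sigma> ?gh x\<bar> \<le> k"
      using k[OF x] by blast
    obtain r2 where r2: "\<forall>p. near r2 x p \<longrightarrow> \<bar>f h p - \<sigma> h x\<bar> \<le> k"
      using k[OF x] by blast
    obtain r3 where r3: "\<forall>p. near r3 (boundary_action h x) p \<longrightarrow> \<bar>f g p - \<sigma> g (boundary_action h x)\<bar> \<le> k"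
      using k[OF action_closed[OF h x]] by blast
    \<comment> \<open>One point serves all three limits; \<open>dist b (h b)\<close> makes up for
      the loss in \<open>near_action\<close> when \<open>h\<close> moves it.\<close>
    obtain p where p: "near (max r1 (max r2 (r3 + dist b (h b)))) x p"
      using approach_boundary[OF x] by blast
    have "\<psi> ((inv\<^bsub>isom_group\<^esub> ?gh) b) p = \<psi> ((inv\<^bsub>isom_group\<^esub> g) b) (h p)"
    proof -
      have "?gh ((inv\<^bsub>isom_group\<^esub> ?gh) b) = b" using inv_apply gh by blast
      then have "g (h ((inv\<^bsub>isom_group\<^esub> ?gh) b)) = b" by (simp only: mult_eq_comp[OF g h] comp_apply)
      then have "h ((inv\<^bsub>isom_group\<^esub> ?gh) b) = (inv\<^bsub>isom_group\<^esub> g) b"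
        using inv_apply(2)[OF g] by metis
      then show ?thesis using invariance[OF h] by metis
    qed
    moreover have "\<psi> ((inv\<^bsub>isom_group\<^esub> h) b) p = \<psi> b (h p)"
      using invariance[OF h, of "(inv\<^bsub>isom_group\<^esub> h) b" p] inv_apply(1)[OF h] by simp
    ultimately have "f ?gh p = f g (h p) + f h p" by (simp add: f_def)
    moreover have "\<bar>f ?gh p - \<sigma> ?gh x\<bar> \<le> k"
      using r1 extended_gromov_product_mono[OF p] by simp
    moreover have "\<bar>f h p - \<sigma> h x\<bar> \<le> k"
      using r2 extended_gromov_product_mono[OF p] by simp
    moreover have "near r3 (boundary_action h x) (h p)"
      by (rule near_action[OF extended_gromov_product_mono[OF p] h]) simp
    then have "\<bar>f g (h p) - \<sigma> g (boundary_action h x)\<bar> \<le> k" using r3 by blast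
    ultimately show "\<bar>\<sigma> ?gh x - (\<sigma> g (boundary_action h x) + \<sigma> h x)\<bar> \<le> 3 * k"
      by linarith
  qed
  with \<open>0 \<le> k\<close> show ?thesis by (intro exI[of _ "3 * k"]) simp
qed

text \<open>
  Along an injective sequence two boundary points are moved together, which is impossible
  if the base point is moved a bounded distance only.
\<close>

lemma displacement_tends_to_infinity:
  fixes \<gamma> :: "nat \<Rightarrow> 'a \<Rightarrow> 'a"
  assumes "inj \<gamma>" "range \<gamma> \<subseteq> \<Gamma>"
  shows "filterlim (\<lambda>n. dist b (\<gamma> n b)) at_top sequentially"
proof (rule ccontr)
  assume "\<not> ?thesis"
  then obtain Z where Z: "\<exists>\<^sub>F n in sequentially. dist b (\<gamma> n b) < Z"
    by (auto simp: filterlim_at_top frequently_def not_less)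
  obtain s :: "nat \<Rightarrow> nat" where s: "strict_mono s" "\<forall>k. dist b (\<gamma> (s k) b) < Z"
    using strict_mono_choice[of "\<lambda>k n. dist b (\<gamma> n b) < Z", OF Z] by blast
  have "range (\<lambda>n. \<gamma> (s n)) \<subseteq> carrier (isom_group\<lparr>carrier := \<Gamma>\<rparr>)" using assms(2) by auto
  then obtain x y r where x: "x \<in> gromov_boundary" and r: "strict_mono r"
    and conv: "loc_unif_const mtopology (\<lambda>n. act (\<gamma> (s (r n)))) (Inr y) (Inr x)"
    using convergence_subsequence[OF inj_subseq[OF assms(1) s(1)]]
    by (auto simp: topspace_gromov_boundary_topology)
  define g where "g n = \<gamma> (s (r n))" for n
  have g: "g n \<in> \<Gamma>" for n using assms(2) by (auto simp: g_def)
  obtain z1 where z1: "z1 \<in> gromov_boundary" "z1 \<noteq> y"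
    using three_points[of y y] by (auto simp: topspace_gromov_boundary_topology)
  obtain z2 where z2: "z2 \<in> gromov_boundary" "z2 \<noteq> y" "z1 \<noteq> z2"
    using three_points[of y z1] by (auto simp: topspace_gromov_boundary_topology)
  obtain c where c: "\<not> ereal c \<le> extended_gromov_product b (Inr z1) (Inr z2)"
    using extended_gromov_product_bounded z1 z2 by blast
  \<comment> \<open>The reserve is \<delta> for comparing the images of \<open>z1\<close> and
    \<open>z2\<close> through \<open>x\<close>, and \<open>Z\<close> for moving the base point to
    \<open>g n b\<close> before pulling back.\<close>
  have lim: "\<forall>\<^sub>F n in sequentially. ereal (c + \<delta> + Z) \<le>
      extended_gromov_product b (Inr x) (Inr (boundary_action (g n) z))"
    if "z \<in> gromov_boundary" "z \<noteq> y" for z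
  proof -
    have "limitin gromov_boundary_topology (\<lambda>n. boundary_action (g n) z) x sequentially"
      using limitin_boundary_of_loc_unif_const[OF conv, of z] that x g
      by (simp add: topspace_gromov_boundary_topology g_def)
    then show ?thesis
      using limitin_boundary[OF x, of "\<lambda>n. boundary_action (g n) z"] action_closed[OF g that(1)] by blast
  qed
  have "\<forall>\<^sub>F n in sequentially. False"
    using lim[OF z1] lim[OF z2(1,2)]
  proof eventually_elim
    case (elim n)
    have "ereal (c + Z) \<le> extended_gromov_product b (Inr (boundary_action (g n) z1)) (Inr (boundary_action (g n) z2))"
      using ultra_boundary[OF elim x] by (simp add: algebra_simps)
    from extended_gromov_product_base[OF this, of "g n b"]
    have "ereal (c + Z - dist b (g n b)) \<le> extended_gromov_product b (Inr z1) (Inr z2)"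
      using extended_gromov_product_isometry[of "g n" b "Inr z1" "Inr z2"] isometry[OF g] by simp
    then show False
      using c extended_gromov_product_mono[of _ b "Inr z1" "Inr z2" c] s(2)[rule_format, of "r n"]
      by (auto simp: g_def)
  qed
  then show False by simp
qed

text \<open>With w = \<gamma>^-1 b, the product of p and w at \<open>b\<close> and the product of p
  and \<open>b\<close> at w add up to \<open>dist b w\<close>. So if \<open>z\<close> is not in the
  direction of w, then for p near \<open>z\<close> the second is almost the whole displacement, and
  \<gamma> carries it to the product of \<gamma> p and \<gamma> b at \<open>b\<close>.\<close>

lemma image_near_orbit:
  assumes \<gamma>: "\<gamma> \<in> \<Gamma>" and z: "z \<in> gromov_boundary" and c: "\<not> near c z ((inv\<^bsub>isom_group\<^esub> \<gamma>) b)"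
  shows "near (dist b (\<gamma> b) - \<bar>c\<bar> - 2 * \<delta>) (boundary_action \<gamma> z) (\<gamma> b)"
proof -
  define w where "w = (inv\<^bsub>isom_group\<^esub> \<gamma>) b"
  have w: "\<gamma> w = b" using inv_apply(1)[OF \<gamma>] by (simp add: w_def)
  have bw: "dist b w = dist b (\<gamma> b)" using isometry[OF \<gamma>, of b w] w by (simp add: dist_commute)
  define D where "D = dist b (\<gamma> b)"
  \<comment> \<open>\<open>near_action\<close> uses up one \<open>D\<close>; what remains exceeds
    the bound claimed.\<close>
  obtain p where p: "near (2 * D + \<bar>c\<bar> + \<delta>) z p" using approach_boundary[OF z] by blast
  have "gromov_product b p w < \<bar>c\<bar> + \<delta>"
  proof (rule ccontr)
    assume "\<not> ?thesis"
    then have pw: "ereal (\<bar>c\<bar> + \<delta>) \<le> extended_gromov_product b (Inl p) (Inl w)"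
      by (simp add: extended_gromov_product_Inl)
    have "ereal (\<bar>c\<bar> + \<delta> - \<delta>) \<le> extended_gromov_product b (Inr z) (Inl w)"
      by (rule ultra[OF extended_gromov_product_mono[OF p] pw]) (auto simp: D_def)
    then show False using c extended_gromov_product_mono[OF _ abs_ge_self, of c b "Inr z" "Inl w"] by (simp add: w_def)
  qed
  moreover have "gromov_product b (\<gamma> p) (\<gamma> b) = gromov_product w p b"
    using gromov_product_isometry[of \<gamma> w p b] isometry[OF \<gamma>] w by simp
  ultimately have "D - \<bar>c\<bar> - \<delta> \<le> gromov_product b (\<gamma> p) (\<gamma> b)"
    using bw by (simp add: D_def gromov_product_def dist_commute)
  then have 1: "ereal (D - \<bar>c\<bar> - \<delta>) \<le> extended_gromov_product b (Inl (\<gamma> p)) (Inl (\<gamma> b))"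
    by (simp add: extended_gromov_product_Inl)
  have "near (D + \<bar>c\<bar> + \<delta>) (boundary_action \<gamma> z) (\<gamma> p)"
    by (rule near_action[OF extended_gromov_product_mono[OF p] \<gamma>]) (simp add: D_def)
  then have 2: "near (D - \<bar>c\<bar> - \<delta>) (boundary_action \<gamma> z) (\<gamma> p)"
    by (rule extended_gromov_product_mono) (use \<delta>_nonneg in simp)
  show ?thesis using ultra[OF 2 1] by (simp add: D_def algebra_simps InlI)
qed

text \<open>Along a convergence subsequence of counterexamples with attracting point
  \<open>x\<close>, the links from \<open>x\<close> to \<gamma> z, on to \<gamma> b and on to \<xi>
  all have large products, so \<xi> tends to \<open>x\<close>. As \<gamma> tends to \<open>x\<close>
  for \<open>d\<close> too, the distance of \<xi> and \<gamma> cannot stay above \<epsilon>.\<close>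

lemma far_in_compactification:
  assumes "\<epsilon> > 0"
  shows "\<exists>c. \<forall>g\<in>\<Gamma>. \<forall>x\<in>gromov_boundary. d (Inr x) (Inl g) > \<epsilon> \<longrightarrow> \<not> near c x (g b)"
proof (rule ccontr)
  assume "\<not> ?thesis"
  then have bad: "\<exists>g\<in>\<Gamma>. \<exists>x\<in>gromov_boundary. d (Inr x) (Inl g) > \<epsilon> \<and> near c x (g b)" for c
    by blast
  define P where "P n z \<longleftrightarrow> fst z \<in> \<Gamma> \<and> snd z \<in> gromov_boundary \<and>
      d (Inr (snd z)) (Inl (fst z)) > \<epsilon> \<and> near (real n) (snd z) (fst z b)" for n :: nat and z
  \<comment> \<open>Increasing displacements make the group elements distinct, as convergence
    dynamics requires.\<close>
  define Q where "Q z z' \<longleftrightarrow> dist b (fst z b) < dist b (fst z' b)"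
    for z z' :: "('a \<Rightarrow> 'a) \<times> (nat \<Rightarrow> 'a) set"
  have ex: "\<exists>z'. P n z' \<and> Q z z'" for n z
  proof -
    define C where "C = max (real n) (dist b (fst z b) + 1)"
    obtain g x where gx: "g \<in> \<Gamma>" "x \<in> gromov_boundary" "d (Inr x) (Inl g) > \<epsilon>" "near C x (g b)"
      using bad by blast
    have "C \<le> dist b (g b)" using le_dist_of_extended_gromov_product gx by blast
    moreover have "near (real n) x (g b)"
      using extended_gromov_product_mono[OF gx(4)] by (simp add: C_def)
    ultimately show ?thesis
      using gx by (intro exI[of _ "(g, x)"]) (simp add: P_def Q_def C_def)
  qed
  obtain f where f: "\<And>n. P n (f n) \<and> Q (f n) (f (Suc n))"
    using dependent_nat_choice[of P "\<lambda>n. Q"] ex by metis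
  define \<gamma> where "\<gamma> n = fst (f n)" for n
  define \<xi> where "\<xi> n = snd (f n)" for n
  have \<gamma>: "\<gamma> n \<in> \<Gamma>" and \<xi>: "\<xi> n \<in> gromov_boundary" and far: "d (Inr (\<xi> n)) (Inl (\<gamma> n)) > \<epsilon>"
    and near_n: "near (real n) (\<xi> n) (\<gamma> n b)" for n
    using f[of n] by (simp_all add: P_def \<gamma>_def \<xi>_def)
  have "strict_mono (\<lambda>n. dist b (\<gamma> n b))"
    using f by (simp add: strict_mono_Suc_iff Q_def \<gamma>_def)
  then have "inj (\<lambda>n. dist b (\<gamma> n b))" by (rule strict_mono_imp_inj_on)
  then have inj: "inj \<gamma>" by (auto simp: inj_def)
  have ran: "range \<gamma> \<subseteq> carrier (isom_group\<lparr>carrier := \<Gamma>\<rparr>)" using \<gamma> by auto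
  obtain x y r where x: "x \<in> gromov_boundary" and r: "strict_mono r"
    and conv: "loc_unif_const mtopology (\<lambda>n. act (\<gamma> (r n))) (Inr y) (Inr x)"
    using convergence_subsequence[OF inj ran] by (auto simp: topspace_gromov_boundary_topology)
  obtain z1 where z1: "z1 \<in> gromov_boundary" "z1 \<noteq> y"
    using three_points[of y y] by (auto simp: topspace_gromov_boundary_topology)
  obtain z2 where z2: "z2 \<in> gromov_boundary" "z2 \<noteq> y" "z1 \<noteq> z2"
    using three_points[of y z1] by (auto simp: topspace_gromov_boundary_topology)
  obtain c where c: "\<not> ereal c \<le> extended_gromov_product b (Inr z1) (Inr z2)"
    using extended_gromov_product_bounded z1 z2 by blast
  define c' where "c' = \<bar>c + \<delta>\<bar>"
  have lim: "\<forall>\<^sub>F n in sequentially. ereal R \<le>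
      extended_gromov_product b (Inr x) (Inr (boundary_action (\<gamma> (r n)) z))"
    if "z \<in> gromov_boundary" "z \<noteq> y" for z R
  proof -
    have "limitin gromov_boundary_topology (\<lambda>n. boundary_action (\<gamma> (r n)) z) x sequentially"
      using limitin_boundary_of_loc_unif_const[OF conv, of z] that x \<gamma>
      by (simp add: topspace_gromov_boundary_topology)
    then show ?thesis
      using limitin_boundary[OF x, of "\<lambda>n. boundary_action (\<gamma> (r n)) z"] action_closed[OF \<gamma> that(1)] by blast
  qed
  have "\<forall>\<^sub>F n in sequentially. ereal R \<le> extended_gromov_product b (Inr x) (Inr (\<xi> (r n)))" for R
    using lim[OF z1, of "R + \<delta>"] lim[OF z2(1,2), of "R + \<delta>"]
      eventually_ge_at_top[of "nat \<lceil>R + c' + 4 * \<delta>\<rceil>"]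
  proof eventually_elim
    case (elim n)
    let ?g = "\<gamma> (r n)"
    \<comment> \<open>\<open>image_near_orbit\<close> loses \<open>c' + 2 * \<delta>\<close>, and
      joining the three links loses another 2\<delta> before \<open>R\<close> is reached.\<close>
    have n: "R + c' + 4 * \<delta> \<le> real (r n)"
      using elim(3) seq_suble[OF r, of n] by linarith
    have dist_g: "real (r n) \<le> dist b (?g b)"
      using le_dist_of_extended_gromov_product[OF near_n \<xi>] .
    \<comment> \<open>The product of \<open>z1\<close> and \<open>z2\<close> is bounded, so the
      orbit point cannot be close to both; which of them is used may change with
      \<open>n\<close>.\<close>
    have "\<not> near (c + \<delta>) z1 ((inv\<^bsub>isom_group\<^esub> ?g) b) \<or> \<not> near (c + \<delta>) z2 ((inv\<^bsub>isom_group\<^esub> ?g) b)"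
      using ultra[of "c + \<delta>" b "Inr z1" "Inl ((inv\<^bsub>isom_group\<^esub> ?g) b)" "Inr z2"] c
      by (auto simp: extended_gromov_product_commute[of b "Inr z2"])
    then obtain z where z: "z \<in> gromov_boundary" "\<not> near (c + \<delta>) z ((inv\<^bsub>isom_group\<^esub> ?g) b)"
      and xz: "ereal (R + \<delta>) \<le> extended_gromov_product b (Inr x) (Inr (boundary_action ?g z))"
      using z1 z2 elim(1,2) by blast
    have "near (dist b (?g b) - c' - 2 * \<delta>) (boundary_action ?g z) (?g b)"
      using image_near_orbit[OF \<gamma> z] by (simp add: c'_def)
    then have 1: "ereal (R + 2 * \<delta>) \<le> extended_gromov_product b (Inr (boundary_action ?g z)) (Inl (?g b))"
      by (rule extended_gromov_product_mono) (use n dist_g in simp)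
    have "near (R + 2 * \<delta>) (\<xi> (r n)) (?g b)"
      by (rule extended_gromov_product_mono[OF near_n]) (use n \<delta>_nonneg in \<open>simp add: c'_def\<close>)
    then have 2: "ereal (R + 2 * \<delta>) \<le> extended_gromov_product b (Inl (?g b)) (Inr (\<xi> (r n)))"
      by (simp add: extended_gromov_product_commute[of b "Inl (?g b)"])
    have 3: "ereal (R + \<delta>) \<le> extended_gromov_product b (Inr (boundary_action ?g z)) (Inr (\<xi> (r n)))"
      using ultra[OF 1 2] by (simp add: algebra_simps InlI)
    show ?case
      using ultra[OF xz 3] action_closed[OF \<gamma> z(1)] by (simp add: InrI)
  qed
  then have "limitin gromov_boundary_topology (\<lambda>n. \<xi> (r n)) x sequentially"
    using limitin_boundary[OF x, of "\<lambda>n. \<xi> (r n)"] \<xi> by blast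
  then have "limitin mtopology (\<lambda>n. Inr (\<xi> (r n))) (Inr x) sequentially"
    using limitin_embedding_map[OF embedding_Inr, of "\<lambda>n. \<xi> (r n)" x] \<xi> x
    by (simp add: topspace_gromov_boundary_topology)
  moreover have "limitin mtopology (\<lambda>n. Inl (\<gamma> (r n))) (Inr x) sequentially"
    using limitin_group_of_loc_unif_const[OF conv] \<gamma> x by (simp add: topspace_gromov_boundary_topology)
  ultimately have "\<forall>\<^sub>F n in sequentially. Inr (\<xi> (r n)) \<in> mball (Inr x) (\<epsilon> / 2)"
    "\<forall>\<^sub>F n in sequentially. Inl (\<gamma> (r n)) \<in> mball (Inr x) (\<epsilon> / 2)"
    using eventually_in_mball half_gt_zero[OF assms] by blast+
  then have "\<forall>\<^sub>F n in sequentially. False"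
  proof eventually_elim
    case (elim n)
    then show False
      using far[of "r n"] triangle[of "Inr (\<xi> (r n))" "Inr x" "Inl (\<gamma> (r n))"]
        commute[of "Inr (\<xi> (r n))" "Inr x"] unfolding in_mball by linarith
  qed
  then show False by simp
qed

text \<open>When \<open>x\<close> is far from \<gamma>^-1, the product of w = \<gamma>^-1 b with
  points p near \<open>x\<close> is bounded, so \<psi>(w, p) splits at \<open>b\<close>. Subtracting
  \<psi>(b, p) leaves \<psi>(w, b), which is \<psi>(b, \<gamma> b) by invariance.\<close>

lemma is_magnitude_sigma:
  "is_magnitude (isom_group\<lparr>carrier := \<Gamma>\<rparr>) gromov_boundary_topology d \<sigma> (\<lambda>\<gamma>. \<psi> b (\<gamma> b))"
  unfolding is_magnitude_def
proof (intro allI impI)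
  fix \<epsilon> :: real assume "\<epsilon> > 0"
  then obtain c where c: "\<And>g x. g \<in> \<Gamma> \<Longrightarrow> x \<in> gromov_boundary \<Longrightarrow> d (Inr x) (Inl g) > \<epsilon> \<Longrightarrow> \<not> near c x (g b)"
    using far_in_compactification by blast
  obtain k where "0 \<le> k"
    and "\<And>\<gamma> x. x \<in> gromov_boundary \<Longrightarrow> \<bar>sigma_potential \<psi> b \<gamma> x\<bar> \<noteq> \<infinity>"
    and k: "\<And>\<gamma> x. x \<in> gromov_boundary \<Longrightarrow>
      \<exists>r. \<forall>p. near r x p \<longrightarrow> \<bar>(\<psi> ((inv\<^bsub>isom_group\<^esub> \<gamma>) b) p - \<psi> b p) - \<sigma> \<gamma> x\<bar> \<le> k"
    by (rule sigma_approx) (rule that)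
  obtain \<kappa> where \<kappa>: "\<kappa> > 0" and add: "\<And>p q u. gromov_product u p q \<le> c + \<delta> \<Longrightarrow>
      \<bar>\<psi> p q - (\<psi> p u + \<psi> u q)\<bar> \<le> \<kappa>"
    using additive_if_gromov_product_le[of "c + \<delta>"] by blast
  have "\<psi> b (\<gamma> b) - (k + \<kappa>) \<le> \<sigma> \<gamma> x \<and> \<sigma> \<gamma> x \<le> \<psi> b (\<gamma> b) + (k + \<kappa>)"
    if \<gamma>: "\<gamma> \<in> \<Gamma>" and x: "x \<in> gromov_boundary"
      and far: "d (Inr x) (Inl (inv\<^bsub>isom_group\<lparr>carrier := \<Gamma>\<rparr>\<^esub> \<gamma>)) > \<epsilon>" for \<gamma> x
  proof -
    define w where "w = (inv\<^bsub>isom_group\<^esub> \<gamma>) b"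
    have w: "\<not> near c x w"
      using c[OF inv_in_group[OF \<gamma>] x] far by (simp add: w_def inv_consistent[OF \<gamma>])
    obtain r where r: "\<forall>p. near r x p \<longrightarrow> \<bar>(\<psi> w p - \<psi> b p) - \<sigma> \<gamma> x\<bar> \<le> k"
      using k[OF x, of \<gamma>] by (auto simp: w_def)
    obtain p where p: "near (max r (c + \<delta>)) x p" using approach_boundary[OF x] by blast
    have "gromov_product b w p \<le> c + \<delta>"
    proof (rule ccontr)
      assume "\<not> ?thesis"
      then have pw: "ereal (c + \<delta>) \<le> extended_gromov_product b (Inl p) (Inl w)"
        by (simp add: extended_gromov_product_Inl gromov_product_commute[of b w])
      have "near (c + \<delta> - \<delta>) x w"
        by (rule ultra[OF extended_gromov_product_mono[OF p] pw]) auto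
      with w show False by simp
    qed
    then have "\<bar>\<psi> w p - (\<psi> w b + \<psi> b p)\<bar> \<le> \<kappa>" by (rule add)
    moreover have "\<psi> w b = \<psi> b (\<gamma> b)"
      using invariance[OF \<gamma>, of w b] inv_apply(1)[OF \<gamma>] by (simp add: w_def)
    moreover have "\<bar>(\<psi> w p - \<psi> b p) - \<sigma> \<gamma> x\<bar> \<le> k"
      using r extended_gromov_product_mono[OF p max.cobounded1] by blast
    ultimately show ?thesis by linarith
  qed
  then show "\<exists>C>0. \<forall>\<gamma>\<in>carrier (isom_group\<lparr>carrier := \<Gamma>\<rparr>). \<forall>x\<in>topspace gromov_boundary_topology.
      \<epsilon> < d (Inr x) (Inl (inv\<^bsub>isom_group\<lparr>carrier := \<Gamma>\<rparr>\<^esub> \<gamma>)) \<longrightarrow>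
      \<psi> b (\<gamma> b) - C \<le> \<sigma> \<gamma> x \<and> \<sigma> \<gamma> x \<le> \<psi> b (\<gamma> b) + C"
    using \<open>0 \<le> k\<close> \<kappa> by (intro exI[of _ "k + \<kappa>"]) (simp add: topspace_gromov_boundary_topology)
qed

lemma proper_cocycle_sigma:
  "proper_cocycle (isom_group\<lparr>carrier := \<Gamma>\<rparr>) gromov_boundary_topology boundary_action d \<sigma>"
  unfolding proper_cocycle_def
proof (intro allI impI, elim conjE)
  fix \<gamma> :: "nat \<Rightarrow> 'a \<Rightarrow> 'a" and a c
  assume inj: "inj \<gamma>"
    and lox: "\<forall>n. loxodromic_with (isom_group\<lparr>carrier := \<Gamma>\<rparr>) gromov_boundary_topology boundary_action
        (\<gamma> n) (a n) (c n)"
    and pos: "0 < liminf (\<lambda>n. ereal (d (Inr (c n)) (Inr (a n))))"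
  have \<gamma>: "\<gamma> n \<in> \<Gamma>" and a: "a n \<in> gromov_boundary" for n
    using lox by (auto simp: loxodromic_with_def conv_limit_set_def topspace_gromov_boundary_topology)
  obtain \<epsilon> where "\<epsilon> > 0" and far: "\<forall>\<^sub>F n in sequentially.
      d (Inr (a n)) (Inl (inv\<^bsub>isom_group\<lparr>carrier := \<Gamma>\<rparr>\<^esub> (\<gamma> n))) > \<epsilon>"
    using loxodromic_attracting_far_from_inverse[OF inj lox[rule_format] pos] by blast
  obtain C where C: "\<forall>\<gamma>\<in>\<Gamma>. \<forall>x\<in>gromov_boundary.
      \<epsilon> < d (Inr x) (Inl (inv\<^bsub>isom_group\<lparr>carrier := \<Gamma>\<rparr>\<^esub> \<gamma>)) \<longrightarrow> \<psi> b (\<gamma> b) - C \<le> \<sigma> \<gamma> x \<and> \<sigma> \<gamma> x \<le> \<psi> b (\<gamma> b) + C"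
    using is_magnitude_sigma[unfolded is_magnitude_def, rule_format, OF \<open>\<epsilon> > 0\<close>]
    unfolding partial_object.update_convs topspace_gromov_boundary_topology by auto
  have "filterlim (\<lambda>n. \<psi> b (\<gamma> n b)) at_top sequentially"
    using displacement_tends_to_infinity[OF inj] \<gamma> by (intro potential_tends_to_infinity) auto
  then have "filterlim (\<lambda>n. - C + \<psi> b (\<gamma> n b)) at_top sequentially"
    by (rule filterlim_tendsto_add_at_top[OF tendsto_const])
  then show "filterlim (\<lambda>n. \<sigma> (\<gamma> n) (a n)) at_top sequentially"
    by (rule filterlim_at_top_mono) (use far in eventually_elim, use C[rule_format, OF \<gamma> a] in force)
qed

section \<open>The reversed potential and the relation between the three functions\<close>

lemma reverse: "potential_group \<delta> (\<lambda>p q. \<psi> q p) \<Gamma> d"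
proof -
  interpret reverse: potential_space b \<delta> "\<lambda>p q. \<psi> q p"
    using geodesic coarsely_additive_potential_reverse[OF potential] by unfold_locales
  show ?thesis
    using reverse.potential_space_axioms compactified_group_axioms subgroup invariant
    by (intro potential_group.intro potential_group_axioms.intro) (simp_all add: invariant_potential_def)
qed

lemma sigma_bar_eq_reverse: "sigma_bar_potential \<psi> b \<gamma> x = sigma_potential (\<lambda>p q. \<psi> q p) b \<gamma> x"
  by (simp add: sigma_bar_potential_def sigma_potential_def)

lemma action_inj:
  assumes "\<gamma> \<in> \<Gamma>" "boundary_action \<gamma> x = boundary_action \<gamma> y"
  shows "x = y"
proof -
  have "inj (\<lambda>u :: nat \<Rightarrow> 'a. \<gamma> \<circ> u)"
    using bij_is_inj[OF bij[OF assms(1)]] by (rule fun.inj_map)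
  with assms(2) show ?thesis by (simp add: boundary_action_def inj_image_eq_iff)
qed

text \<open>With h(p, q) for the expression whose upper limit is G, and w = \<gamma>^-1 b,
  invariance gives exactly h(\<gamma> p, \<gamma> q) - h(p, q) = (\<psi>(p, w) - \<psi>(p, b)) +
  (\<psi>(w, q) - \<psi>(b, q)). Four limits are replaced by values, two of them limits defining G,
  whence \<open>k + k' + 2 * l\<close>.\<close>

lemma sigma_bar_plus_sigma:
  "\<exists>\<kappa>. \<forall>\<gamma>\<in>\<Gamma>. \<forall>(x, y) \<in> distinct_pairs gromov_boundary_topology.
     \<bar>(real_of_ereal (sigma_bar_potential \<psi> b \<gamma> x) + \<sigma> \<gamma> y) -
      (real_of_ereal (G_potential \<psi> b (boundary_action \<gamma> x, boundary_action \<gamma> y)) -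
       real_of_ereal (G_potential \<psi> b (x, y)))\<bar> \<le> \<kappa>"
proof -
  interpret reverse: potential_group b \<delta> "\<lambda>p q. \<psi> q p" \<Gamma> d by (rule reverse)
  let ?G = "\<lambda>x y. real_of_ereal (G_potential \<psi> b (x, y))"
  obtain k where "0 \<le> k"
    and "\<And>\<gamma> x. x \<in> gromov_boundary \<Longrightarrow> \<bar>sigma_potential \<psi> b \<gamma> x\<bar> \<noteq> \<infinity>"
    and k: "\<And>\<gamma> x. x \<in> gromov_boundary \<Longrightarrow>
      \<exists>r. \<forall>p. near r x p \<longrightarrow> \<bar>(\<psi> ((inv\<^bsub>isom_group\<^esub> \<gamma>) b) p - \<psi> b p) - \<sigma> \<gamma> x\<bar> \<le> k"
    by (rule sigma_approx) (rule that)
  obtain k' where "0 \<le> k'"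
    and "\<And>\<gamma> x. x \<in> gromov_boundary \<Longrightarrow> \<bar>sigma_potential (\<lambda>p q. \<psi> q p) b \<gamma> x\<bar> \<noteq> \<infinity>"
    and k': "\<And>\<gamma> x. x \<in> gromov_boundary \<Longrightarrow>
      \<exists>r. \<forall>p. near r x p \<longrightarrow> \<bar>(\<psi> p ((inv\<^bsub>isom_group\<^esub> \<gamma>) b) - \<psi> p b) - reverse.\<sigma> \<gamma> x\<bar> \<le> k'"
    by (rule reverse.sigma_approx) (rule that)
  obtain l where "0 \<le> l"
    and "\<And>x y. x \<in> gromov_boundary \<Longrightarrow> y \<in> gromov_boundary \<Longrightarrow> x \<noteq> y \<Longrightarrow> \<bar>G_potential \<psi> b (x, y)\<bar> \<noteq> \<infinity>"
    and l: "\<And>x y. x \<in> gromov_boundary \<Longrightarrow> y \<in> gromov_boundary \<Longrightarrow> x \<noteq> y \<Longrightarrow>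
      \<exists>r. \<forall>p q. near r x p \<longrightarrow> near r y q \<longrightarrow>
        \<bar>(\<psi> p b + \<psi> b q - \<psi> p q) - real_of_ereal (G_potential \<psi> b (x, y))\<bar> \<le> l"
    by (rule G_potential_approx) (rule that)
  have "\<bar>(real_of_ereal (sigma_bar_potential \<psi> b \<gamma> x) + \<sigma> \<gamma> y) -
      (?G (boundary_action \<gamma> x) (boundary_action \<gamma> y) - ?G x y)\<bar> \<le> k + k' + 2 * l"
    if \<gamma>: "\<gamma> \<in> \<Gamma>" and x: "x \<in> gromov_boundary" and y: "y \<in> gromov_boundary" and "x \<noteq> y" for \<gamma> x y
  proof -
    define w where "w = (inv\<^bsub>isom_group\<^esub> \<gamma>) b"
    have w: "\<gamma> w = b" using inv_apply(1)[OF \<gamma>] by (simp add: w_def)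
    define D where "D = dist b (\<gamma> b)"
    let ?x = "boundary_action \<gamma> x" and ?y = "boundary_action \<gamma> y"
    have "?x \<noteq> ?y" using action_inj[OF \<gamma>] \<open>x \<noteq> y\<close> by blast
    obtain r1 where r1: "\<forall>q. near r1 y q \<longrightarrow> \<bar>(\<psi> w q - \<psi> b q) - \<sigma> \<gamma> y\<bar> \<le> k"
      using k[OF y, of \<gamma>] unfolding w_def by (elim exE)
    obtain r2 where r2: "\<forall>p. near r2 x p \<longrightarrow> \<bar>(\<psi> p w - \<psi> p b) - reverse.\<sigma> \<gamma> x\<bar> \<le> k'"
      using k'[OF x, of \<gamma>] unfolding w_def by (elim exE)
    obtain r3 where r3: "\<forall>p q. near r3 x p \<longrightarrow> near r3 y q \<longrightarrow> \<bar>(\<psi> p b + \<psi> b q - \<psi> p q) - ?G x y\<bar> \<le> l"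
      using l[OF x y \<open>x \<noteq> y\<close>] by (elim exE)
    obtain r4 where r4: "\<forall>p q. near r4 ?x p \<longrightarrow> near r4 ?y q \<longrightarrow> \<bar>(\<psi> p b + \<psi> b q - \<psi> p q) - ?G ?x ?y\<bar> \<le> l"
      using l[OF action_closed[OF \<gamma> x] action_closed[OF \<gamma> y] \<open>?x \<noteq> ?y\<close>] by (elim exE)
    define r where "r = max (max r1 r2) (max r3 (r4 + D))"
    obtain p where p: "near r x p" using approach_boundary[OF x] by blast
    obtain q where q: "near r y q" using approach_boundary[OF y] by blast
    have "\<bar>(\<psi> w q - \<psi> b q) - \<sigma> \<gamma> y\<bar> \<le> k"
      using r1 extended_gromov_product_mono[OF q, of r1] by (simp add: r_def)
    moreover have "\<bar>(\<psi> p w - \<psi> p b) - reverse.\<sigma> \<gamma> x\<bar> \<le> k'"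
      using r2 extended_gromov_product_mono[OF p, of r2] by (simp add: r_def)
    moreover have "\<bar>(\<psi> p b + \<psi> b q - \<psi> p q) - ?G x y\<bar> \<le> l"
      using r3 extended_gromov_product_mono[OF p, of r3] extended_gromov_product_mono[OF q, of r3]
      by (simp add: r_def)
    moreover have "\<bar>(\<psi> (\<gamma> p) b + \<psi> b (\<gamma> q) - \<psi> (\<gamma> p) (\<gamma> q)) - ?G ?x ?y\<bar> \<le> l"
    proof -
      have "near r4 ?x (\<gamma> p)" "near r4 ?y (\<gamma> q)"
        by (rule near_action[OF _ \<gamma>], rule extended_gromov_product_mono[OF p], simp add: r_def D_def)
          (rule near_action[OF _ \<gamma>], rule extended_gromov_product_mono[OF q], simp add: r_def D_def)
      then show ?thesis using r4 by blast
    qed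
    moreover have "\<psi> (\<gamma> p) b = \<psi> p w" "\<psi> b (\<gamma> q) = \<psi> w q" "\<psi> (\<gamma> p) (\<gamma> q) = \<psi> p q"
      using invariance[OF \<gamma>, of p w] invariance[OF \<gamma>, of w q] invariance[OF \<gamma>, of p q] w by simp_all
    moreover have "real_of_ereal (sigma_bar_potential \<psi> b \<gamma> x) = reverse.\<sigma> \<gamma> x"
      by (simp only: sigma_bar_eq_reverse)
    ultimately show ?thesis by linarith
  qed
  then show ?thesis
    by (intro exI[of _ "k + k' + 2 * l"])
       (auto simp: distinct_pairs_def topspace_gromov_boundary_topology)
qed

lemma coarse_GPS_system_potential:
  "coarse_GPS_system (isom_group\<lparr>carrier := \<Gamma>\<rparr>) gromov_boundary_topology boundary_action d
     \<sigma> (\<lambda>\<gamma> x. real_of_ereal (sigma_bar_potential \<psi> b \<gamma> x)) (\<lambda>z. real_of_ereal (G_potential \<psi> b z))"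
proof -
  interpret reverse: potential_group b \<delta> "\<lambda>p q. \<psi> q p" \<Gamma> d by (rule reverse)
  let ?G = "isom_group\<lparr>carrier := \<Gamma>\<rparr>" and ?M = "gromov_boundary_topology :: (nat \<Rightarrow> 'a) set topology"
  obtain k where k: "0 \<le> k" "coarse_cocycle ?G ?M boundary_action k \<sigma>"
    using coarse_cocycle_sigma by blast
  obtain k' where k': "0 \<le> k'" "coarse_cocycle ?G ?M boundary_action k' reverse.\<sigma>"
    using reverse.coarse_cocycle_sigma by blast
  obtain l where l: "\<forall>\<gamma>\<in>\<Gamma>. \<forall>(x, y) \<in> distinct_pairs ?M.
     \<bar>(real_of_ereal (sigma_bar_potential \<psi> b \<gamma> x) + \<sigma> \<gamma> y) -
      (real_of_ereal (G_potential \<psi> b (boundary_action \<gamma> x, boundary_action \<gamma> y)) -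
       real_of_ereal (G_potential \<psi> b (x, y)))\<bar> \<le> l"
    using sigma_bar_plus_sigma by blast
  define \<kappa> where "\<kappa> = max k (max k' l)"
  have "0 \<le> \<kappa>" "k \<le> \<kappa>" "k' \<le> \<kappa>" "l \<le> \<kappa>" using k(1) by (auto simp: \<kappa>_def)
  then show ?thesis
    unfolding coarse_GPS_system_def sigma_bar_eq_reverse
    using coarse_cocycle_mono[OF k(2)] coarse_cocycle_mono[OF k'(2)] proper_cocycle_sigma
      reverse.proper_cocycle_sigma G_potential_locally_bounded l[unfolded sigma_bar_eq_reverse]
    by (intro exI[of _ \<kappa>]) fastforce
qed

end

theorem theorem1p11:
  fixes b :: "'a::metric_space"
    and \<Gamma> :: "('a \<Rightarrow> 'a) set"
    and \<psi> :: "'a \<Rightarrow> 'a \<Rightarrow> real"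
    and d :: "('a \<Rightarrow> 'a) + (nat \<Rightarrow> 'a) set \<Rightarrow> ('a \<Rightarrow> 'a) + (nat \<Rightarrow> 'a) set \<Rightarrow> real"
  assumes "proper_space TYPE('a)"
    and "geodesic_space TYPE('a)"
    and "gromov_hyperbolic TYPE('a)"
    and "subgroup \<Gamma> isom_group"
    and "discrete \<Gamma>"
    and "non_elementary (isom_group\<lparr>carrier := \<Gamma>\<rparr>) gromov_boundary_topology boundary_action"
    and "compatible_metric (isom_group\<lparr>carrier := \<Gamma>\<rparr>) gromov_boundary_topology boundary_action d"
    and "coarsely_additive_potential \<psi>"
    and "invariant_potential \<Gamma> \<psi>"
  shows
    "(\<forall>\<gamma>\<in>\<Gamma>. \<forall>x\<in>gromov_boundary.
        \<bar>sigma_potential \<psi> b \<gamma> x\<bar> \<noteq> \<infinity> \<and> \<bar>sigma_bar_potential \<psi> b \<gamma> x\<bar> \<noteq> \<infinity>) \<and>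
     (\<forall>z\<in>distinct_pairs gromov_boundary_topology. \<bar>G_potential \<psi> b z\<bar> \<noteq> \<infinity>) \<and>
     (\<exists>B::real. \<forall>z\<in>distinct_pairs gromov_boundary_topology. ereal B \<le> G_potential \<psi> b z) \<and>
     coarse_GPS_system (isom_group\<lparr>carrier := \<Gamma>\<rparr>) gromov_boundary_topology boundary_action d
       (\<lambda>\<gamma> x. real_of_ereal (sigma_potential \<psi> b \<gamma> x))
       (\<lambda>\<gamma> x. real_of_ereal (sigma_bar_potential \<psi> b \<gamma> x))
       (\<lambda>z. real_of_ereal (G_potential \<psi> b z)) \<and>
     is_magnitude (isom_group\<lparr>carrier := \<Gamma>\<rparr>) gromov_boundary_topology d
       (\<lambda>\<gamma> x. real_of_ereal (sigma_potential \<psi> b \<gamma> x))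
       (\<lambda>\<gamma>. \<psi> b (\<gamma> b))"
proof -
  obtain \<delta> where \<delta>: "\<delta> \<ge> 0" "\<And>a x y z::'a.
      gromov_product a x z \<ge> min (gromov_product a x y) (gromov_product a y z) - \<delta>"
    using assms(3) unfolding gromov_hyperbolic_def by blast
  let ?G = "isom_group\<lparr>carrier := \<Gamma>\<rparr>" and ?M = "gromov_boundary_topology :: (nat \<Rightarrow> 'a) set topology"
  \<comment> \<open>The limit set lies in the boundary and has more than two points; this is where
    non-elementarity enters.\<close>
  have "\<exists>z\<in>topspace ?M. z \<noteq> x \<and> z \<noteq> y" for x y
  proof (rule ccontr)
    assume "\<not> ?thesis"
    then have "conv_limit_set ?G ?M boundary_action \<subseteq> {x, y}" by (auto simp: conv_limit_set_def)
    then have "finite (conv_limit_set ?G ?M boundary_action)"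
      "card (conv_limit_set ?G ?M boundary_action) \<le> card {x, y}"
      by (auto intro: finite_subset card_mono)
    moreover have "card {x, y} \<le> 2" by (simp add: card_insert_if)
    ultimately show False using assms(6) by (simp add: non_elementary_def)
  qed
  then interpret potential_group b \<delta> \<psi> \<Gamma> d
    using \<delta> assms group.subgroup_imp_group[OF group_isom_group assms(4)]
    by (intro potential_group.intro potential_space.intro compactified_group.intro
        hyperbolic_space.intro potential_space_axioms.intro compactified_group_axioms.intro
        potential_group_axioms.intro) auto
  interpret reverse: potential_group b \<delta> "\<lambda>p q. \<psi> q p" \<Gamma> d by (rule reverse)
  have finite: "\<bar>sigma_potential \<psi> b \<gamma> x\<bar> \<noteq> \<infinity>" if "x \<in> gromov_boundary" for \<gamma> x
    by (rule sigma_approx) (use that in simp)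
  have finite_bar: "\<bar>sigma_bar_potential \<psi> b \<gamma> x\<bar> \<noteq> \<infinity>" if "x \<in> gromov_boundary" for \<gamma> x
    unfolding sigma_bar_eq_reverse by (rule reverse.sigma_approx) (use that in simp)
  have finite_G: "\<bar>G_potential \<psi> b z\<bar> \<noteq> \<infinity>" if z: "z \<in> distinct_pairs ?M" for z
  proof -
    obtain x y where z: "z = (x, y)" "x \<in> gromov_boundary" "y \<in> gromov_boundary" "x \<noteq> y"
      using z by (cases z) (auto simp: distinct_pairs_def topspace_gromov_boundary_topology)
    show ?thesis
      unfolding z(1) by (rule G_potential_approx) (use z(2-4) in simp)
  qed
  show ?thesis
    by (intro conjI ballI finite finite_bar finite_G G_potential_bounded_below
        coarse_GPS_system_potential is_magnitude_sigma)
qed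

end
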